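(* Let $\Phi$, $a$, $\bar y_\kappa$ ($\kappa>0$) and $y_0$ be as described in the context. There exist constants $\delta_1>0$, $C>0$ and $\kappa_0>0$ such that for all $0<\kappa\le\kappa_0$ and all $s\ge 0$, \[ |\bar y_\kappa(s)-y_0(s)|\le C\kappa^{\delta_1}. \]
   Context: Let $\Phi:\mathbb R\to[0,\infty[$ be measurable with $\Phi(\eta)=0$ for $\eta<0$ and, as $\eta\to0+$, $\Phi(\eta)=C_\Phi\eta^k+\mathrm O(\eta^{k+\delta})$, where $0<k<3/2$, $\delta>0$, $C_\Phi>0$. Put $a=(k+1/2)/2$. Relativistic steady states: define for $y\in\mathbb R$ $g(y)=4\pi e^{3y}\int_0^{1-e^{-y}}\Phi(\eta)(1-\eta)^2\big(e^{2y}(1-\eta)^2-1\big)^{1/2}d\eta$ and $P(y)=\frac{4\pi}{3}e^{y}\int_0^{1-e^{-y}}\Phi(\eta)\big(e^{2y}(1-\eta)^2-1\big)^{3/2}d\eta$ for $y>0$, and $g(y)=P(y)=0$ for $y\le0$. For $\kappa>0$ let $y_\kappa:[0,\infty[\to\mathbb R$ be the (global, unique) solution of $y'(r)=-\frac{1}{1-2m(r)/r}\big(\frac{m(r)}{r^2}+4\pi rP(y(r))\big)$, $y(0)=\kappa$, where $m(r)=4\pi\int_0^r\sigma^2 g(y(\sigma))\,d\sigma$. Define $\bar y_\kappa(s):=\kappa^{-1}y_\kappa(\kappa^{-a}s)$, $s\ge0$. Equivalently, $\bar y_\kappa$ is the solution on $[0,\infty[$ of the rescaled problem \[ \bar y'(s)=-\frac{1}{1-\kappa\frac{2\bar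 m_\kappa(s)}{s}}\Big(\frac{\bar m_\kappa(s)}{s^2}+4\pi\kappa s\,H_\kappa(\bar y(s))\Big),\quad \bar y(0)=1,\quad \bar m_\kappa(s)=4\pi\int_0^s\sigma^2 g_\kappa(\bar y(\sigma))\,d\sigma, \] where: $F_\kappa$ is defined by $e^{-\kappa x}=1-\kappa x+\kappa^2F_\kappa(x)$ for $x\ge0$; $G_\kappa(x,\eta)=\eta^2-F_\kappa(2x)$; $\Phi_\kappa(\eta)=\kappa^{1/2-2a}\Phi(\kappa\eta)$; and for $x>0$ $g_\kappa(x)=4\pi e^{4\kappa x}\int_0^{x-\kappa F_\kappa(x)}\Phi_\kappa(\eta)(1-\kappa\eta)^2\big(2(x-\eta)+\kappa G_\kappa(x,\eta)\big)^{1/2}d\eta$, $H_\kappa(x)=\frac{4\pi}{3}e^{4\kappa x}\int_0^{x-\kappa F_\kappa(x)}\Phi_\kappa(\eta)\big(2(x-\eta)+\kappa G_\kappa(x,\eta)\big)^{3/2}d\eta$, with $g_\kappa(x)=H_\kappa(x)=0$ for $x\le0$. Newtonian limit: $\Phi_0(\eta):=\lim_{\kappa\to0}\Phi_\kappa(\eta)$ (i.e. $C_\Phi\eta^k$ for $\eta>0$, $0$ for $\eta<0$); $g_0(x)=4\pi\sqrt2\int_0^x\Phi_0(\eta)(x-\eta)^{1/2}d\eta$ for $x>0$, $g_0(x)=0$ for $x\le0$; $y_0$ is the solution on $[0,\infty[$ of $y'(r)=-m_0(r)/r^2$, $y(0)=1$, with $m_0(r)=4\pi\int_0^r\sigma^2g_0(y(\sigma))\,d\sigma$.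 *)

theory Defs
  imports "HOL-Analysis.Analysis" "HOL-Library.Landau_Symbols"
begin

definition g_rel :: "(real \<Rightarrow> real) \<Rightarrow> real \<Rightarrow> real" where
  "g_rel \<Phi> y = (if y \<le> 0 then 0 else
     4 * pi * exp (3 * y) *
     set_lebesgue_integral lborel {0 .. 1 - exp (- y)}
       (\<lambda>\<eta>. \<Phi> \<eta> * (1 - \<eta>)^2 * sqrt (exp (2 * y) * (1 - \<eta>)^2 - 1)))"

definition P_rel :: "(real \<Rightarrow> real) \<Rightarrow> real \<Rightarrow> real" where
  "P_rel \<Phi> y = (if y \<le> 0 then 0 else
     4 * pi / 3 * exp y *
     set_lebesgue_integral lborel {0 .. 1 - exp (- y)}
       (\<lambda>\<eta>. \<Phi> \<eta> * (exp (2 * y) * (1 - \<eta>)^2 - 1) powr (3 / 2)))"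

definition mass_rel :: "(real \<Rightarrow> real) \<Rightarrow> (real \<Rightarrow> real) \<Rightarrow> real \<Rightarrow> real" where
  "mass_rel \<Phi> y r = 4 * pi *
     set_lebesgue_integral lborel {0 .. r} (\<lambda>\<sigma>. \<sigma>^2 * g_rel \<Phi> (y \<sigma>))"

definition is_rel_solution :: "(real \<Rightarrow> real) \<Rightarrow> real \<Rightarrow> (real \<Rightarrow> real) \<Rightarrow> bool" where
  "is_rel_solution \<Phi> \<kappa> y \<longleftrightarrow>
     y 0 = \<kappa> \<and> continuous_on {0..} y \<and>
     (\<forall>r > 0. 1 - 2 * mass_rel \<Phi> y r / r > 0 \<and>
        (y has_real_derivative
           (- (1 / (1 - 2 * mass_rel \<Phi> y r / r)) *
              (mass_rel \<Phi> y r / r^2 + 4 * pi * r * P_rel \<Phi> (y r)))) (at r))"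

definition Phi0 :: "real \<Rightarrow> real \<Rightarrow> real \<Rightarrow> real" where
  "Phi0 C k \<eta> = (if \<eta> > 0 then C * \<eta> powr k else 0)"

definition g_newt :: "real \<Rightarrow> real \<Rightarrow> real \<Rightarrow> real" where
  "g_newt C k x = (if x \<le> 0 then 0 else
     4 * pi * sqrt 2 *
     set_lebesgue_integral lborel {0 .. x} (\<lambda>\<eta>. Phi0 C k \<eta> * sqrt (x - \<eta>)))"

definition mass_newt :: "real \<Rightarrow> real \<Rightarrow> (real \<Rightarrow> real) \<Rightarrow> real \<Rightarrow> real" where
  "mass_newt C k y r = 4 * pi *
     set_lebesgue_integral lborel {0 .. r} (\<lambda>\<sigma>. \<sigma>^2 * g_newt C k (y \<sigma>))"

definition is_newt_solution :: "real \<Rightarrow> real \<Rightarrow> (real \<Rightarrow> real) \<Rightarrow> bool" where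
  "is_newt_solution C k y \<longleftrightarrow>
     y 0 = 1 \<and> continuous_on {0..} y \<and>
     (\<forall>r > 0. (y has_real_derivative (- mass_newt C k y r / r^2)) (at r))"

end

theory Submission
  imports Defs "HOL-Real_Asymp.Real_Asymp"
begin

text \<open>Rescaling turns the relativistic equation into the Newtonian one up to a factor \<open>1 / (1 - O(\<kappa>))\<close>,
  a pressure term of size \<open>O(\<kappa>)\<close> and a density that differs from \<open>g\<^sub>0(x) = c x\<^sup>n\<close>, \<open>n = k + 3/2\<close>,
  by \<open>O(\<kappa>\<^sup>d)\<close> with \<open>d = min \<delta> 1\<close>. Since \<open>g\<^sub>0\<close> is homogeneous, the last claim reduces to the single expansion
  \<open>g(y) = c y\<^sup>n + O(y\<^bsup>n+d\<^esup>)\<close> at \<open>y = 0\<close>. As \<open>g\<^sub>0\<close> is Lipschitz on \<open>{..1}\<close>, a Gronwall argument in an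
  exponentially weighted sup norm compares the solutions on a compact interval \<open>[0, S]\<close>. The condition
  \<open>k < 3/2\<close> means \<open>n < 3\<close>, which forces \<open>y\<^sub>0\<close> to become negative at some \<open>S\<close>; for small \<open>\<kappa>\<close> the
  rescaled solution is then negative at \<open>S\<close> too, so beyond \<open>S\<close> both masses are constant and the
  derivatives differ by \<open>O(\<kappa>\<^sup>d / s\<^sup>2)\<close>, which is integrable.\<close>

section \<open>Mass functions\<close>

text \<open>\<open>mass_rel\<close> and \<open>mass_newt\<close> are the instances for
  \<open>g_rel \<Phi>\<close> and \<open>g_newt C k\<close>, so one set of estimates serves both
  equations of state.\<close>

definition mass :: "(real \<Rightarrow> real) \<Rightarrow> (real \<Rightarrow> real) \<Rightarrow> real \<Rightarrow> real" where
  "mass g y r = 4 * pi * set_lebesgue_integral lborel {0..r} (\<lambda>\<sigma>. \<sigma>^2 * g (y \<sigma>))"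

lemma set_integrable_bounded_interval:
  fixes f :: "real \<Rightarrow> real"
  assumes "set_borel_measurable borel {a..b} f" "\<And>x. x \<in> {a..b} \<Longrightarrow> \<bar>f x\<bar> \<le> B"
  shows "set_integrable lborel {a..b} f"
  unfolding set_integrable_def
proof (rule integrableI_bounded_set[where A = "{a..b}" and B = B])
  show "(\<lambda>x. indicator {a..b} x *\<^sub>R f x) \<in> borel_measurable lborel"
    using assms(1) by (simp add: set_borel_measurable_def)
  show "AE x in lborel. x \<in> {a..b} \<longrightarrow> norm (indicat_real {a..b} x *\<^sub>R f x) \<le> B"
    using assms(2) by auto
qed (auto simp: emeasure_lborel_Icc_eq)

lemma set_integral_nonneg_on:
  fixes f :: "real \<Rightarrow> real"
  assumes "\<And>x. x \<in> A \<Longrightarrow> 0 \<le> f x"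
  shows "0 \<le> set_lebesgue_integral M A f"
  unfolding set_lebesgue_integral_def
  by (rule integral_nonneg_AE) (use assms in \<open>auto simp: indicator_def\<close>)

lemma mass_nonneg:
  assumes "\<And>x. 0 \<le> g x"
  shows "0 \<le> mass g y r"
  using assms by (auto simp: mass_def intro!: mult_nonneg_nonneg set_integral_nonneg_on)

text \<open>Common ground of both problems: the potentials start at 1 and decrease, so a bound on
  the density over \<open>{..1}\<close> controls the mass.\<close>

locale bounded_density =
  fixes g y :: "real \<Rightarrow> real" and A :: real
  assumes g_meas [measurable]: "g \<in> borel_measurable borel"
    and g_nonneg: "\<And>x. 0 \<le> g x"
    and g_le: "\<And>x. x \<le> 1 \<Longrightarrow> g x \<le> A"
    and y_cont: "continuous_on {0..} y"
    and y_le: "\<And>s. 0 \<le> s \<Longrightarrow> y s \<le> 1"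
begin

lemma A_nonneg: "0 \<le> A"
  using g_nonneg[of 0] g_le[of 0] by linarith

lemma mass_integrable: "set_integrable lborel {0..r} (\<lambda>\<sigma>. \<sigma>^2 * g (y \<sigma>))"
proof (rule set_integrable_bounded_interval)
  \<comment> \<open>\<open>y\<close> is continuous only on \<open>{0..}\<close>; composing with
    \<open>max 0\<close> extends it continuously to the whole line without changing the integrand on
    \<open>{0..r}\<close>.\<close>
  have "continuous_on UNIV (\<lambda>\<sigma>. y (max 0 \<sigma>))"
    by (rule continuous_on_compose2[OF y_cont]) (auto intro!: continuous_intros)
  then have [measurable]: "(\<lambda>\<sigma>. y (max 0 \<sigma>)) \<in> borel_measurable borel"
    by (rule borel_measurable_continuous_onI)
  have "set_borel_measurable borel {0..r} (\<lambda>\<sigma>. \<sigma>^2 * g (y (max 0 \<sigma>)))"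
    unfolding set_borel_measurable_def by measurable
  moreover have "(\<lambda>\<sigma>. indicat_real {0..r} \<sigma> *\<^sub>R (\<sigma>^2 * g (y (max 0 \<sigma>)))) =
      (\<lambda>\<sigma>. indicat_real {0..r} \<sigma> *\<^sub>R (\<sigma>^2 * g (y \<sigma>)))"
    by (auto simp: indicator_def)
  ultimately show "set_borel_measurable borel {0..r} (\<lambda>\<sigma>. \<sigma>^2 * g (y \<sigma>))"
    by (simp only: set_borel_measurable_def)
  show "\<bar>\<sigma>^2 * g (y \<sigma>)\<bar> \<le> r^2 * A" if "\<sigma> \<in> {0..r}" for \<sigma>
    using that g_nonneg[of "y \<sigma>"] g_le[of "y \<sigma>"] y_le[of \<sigma>]
    by (auto simp: abs_mult intro!: mult_mono power_mono)
qed

lemma mass_le: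
  assumes "0 \<le> r"
  shows "mass g y r \<le> 4 * pi * A * r^3"
proof -
  have "(LINT \<sigma>:{0..r}|lborel. \<sigma>^2 * g (y \<sigma>)) \<le> (LINT \<sigma>:{0..r}|lborel. r^2 * A)"
    by (rule set_integral_mono[OF mass_integrable])
      (use A_nonneg y_le g_le g_nonneg in \<open>auto intro!: mult_mono power_mono set_integrable_bounded_interval[where B = "\<bar>r^2 * A\<bar>"] simp: set_borel_measurable_def\<close>)
  also have "\<dots> = A * r^3"
    using assms by (simp add: set_lebesgue_integral_def power2_eq_square power3_eq_cube)
  finally show ?thesis
    by (simp add: mass_def)
qed

lemma mass_diff:
  assumes "0 \<le> r" "r \<le> R"
  shows "mass g y R - mass g y r = 4 * pi * (LINT \<sigma>:{r<..R}|lborel. \<sigma>^2 * g (y \<sigma>))"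
proof -
  have "(LINT \<sigma>:{0..r} \<union> {r<..R}|lborel. \<sigma>^2 * g (y \<sigma>)) =
      (LINT \<sigma>:{0..r}|lborel. \<sigma>^2 * g (y \<sigma>)) + (LINT \<sigma>:{r<..R}|lborel. \<sigma>^2 * g (y \<sigma>))"
    by (rule set_integral_Un[OF _ mass_integrable set_integrable_subset[OF mass_integrable[of R]]])
      (use assms in auto)
  moreover have "{0..r} \<union> {r<..R} = {0..R}"
    using assms by auto
  ultimately show ?thesis
    by (simp add: mass_def algebra_simps)
qed

lemma mass_mono:
  assumes "0 \<le> r" "r \<le> R"
  shows "mass g y r \<le> mass g y R"
proof -
  have "0 \<le> (LINT \<sigma>:{r<..R}|lborel. \<sigma>^2 * g (y \<sigma>))"
    by (rule set_integral_nonneg_on) (simp add: g_nonneg)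
  then show ?thesis
    using mass_diff[OF assms] by (simp add: zero_le_mult_iff algebra_simps)
qed

lemma mass_eq_vacuum:
  assumes "0 \<le> r" "r \<le> R" and "\<And>s. r \<le> s \<Longrightarrow> y s \<le> 0" and "\<And>x. x \<le> 0 \<Longrightarrow> g x = 0"
  shows "mass g y R = mass g y r"
proof -
  have "(LINT \<sigma>:{r<..R}|lborel. \<sigma>^2 * g (y \<sigma>)) = (LINT \<sigma>:{r<..R}|lborel. 0)"
    by (rule set_lebesgue_integral_cong) (use assms in auto)
  then show ?thesis
    using mass_diff[OF assms(1,2)] by simp
qed

lemma mass_ge:
  assumes "0 \<le> r" "0 \<le> m" "\<And>s. 0 \<le> s \<Longrightarrow> s \<le> r \<Longrightarrow> m \<le> g (y s)"
  shows "4 * pi / 3 * m * r^3 \<le> mass g y r"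
proof -
  have "((\<lambda>\<sigma>. \<sigma>^2 * m) has_integral (m * r^3 / 3 - m * 0^3 / 3)) {0..r}"
    using assms(1) by (intro fundamental_theorem_of_calculus)
      (auto intro!: derivative_eq_intros simp flip: has_real_derivative_iff_has_vector_derivative)
  moreover have int: "set_integrable lborel {0..r} (\<lambda>\<sigma>. \<sigma>^2 * m)"
    by (rule borel_integrable_compact[of "{0..r}", unfolded set_integrable_def[symmetric]] )
      (auto intro!: continuous_intros)
  ultimately have "(LINT \<sigma>:{0..r}|lborel. \<sigma>^2 * m) = m * r^3 / 3"
    by (subst set_borel_integral_eq_integral(2)) (auto dest: integral_unique)
  moreover have "(LINT \<sigma>:{0..r}|lborel. \<sigma>^2 * m) \<le> (LINT \<sigma>:{0..r}|lborel. \<sigma>^2 * g (y \<sigma>))"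
    by (rule set_integral_mono[OF int mass_integrable]) (use assms in \<open>auto intro!: mult_left_mono\<close>)
  ultimately have "m * r^3 / 3 \<le> (LINT \<sigma>:{0..r}|lborel. \<sigma>^2 * g (y \<sigma>))"
    by (simp only:)
  then have "4 * pi * (m * r^3 / 3) \<le> 4 * pi * (LINT \<sigma>:{0..r}|lborel. \<sigma>^2 * g (y \<sigma>))"
    by (intro mult_left_mono) auto
  then show ?thesis
    by (simp add: mass_def mult_ac)
qed

end

text \<open>The constant \<open>a\<close> will carry the error of the equation of state, the
  exponential the weighted distance of the potentials. Integrating the exponential gains one factor
  \<open>1 / l\<close>; integrating the field equation will gain the second.\<close>

lemma mass_diff_le:
  assumes "bounded_density g y A" "bounded_density g' y' A'" "0 \<le> r" "0 < l" "0 \<le> a" "0 \<le> b"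
    and bd: "\<And>s. 0 \<le> s \<Longrightarrow> s \<le> r \<Longrightarrow> \<bar>g (y s) - g' (y' s)\<bar> \<le> a + b * exp (l * s)"
  shows "\<bar>mass g y r - mass g' y' r\<bar> \<le> 4 * pi * r^2 * (a * r + b * exp (l * r) / l)"
proof -
  interpret D: bounded_density g y A by fact
  interpret D': bounded_density g' y' A' by fact
  let ?f = "\<lambda>\<sigma>. r^2 * (a + b * exp (l * \<sigma>))"
  have hi: "(?f has_integral (r^2 * (a * r + b * exp (l * r) / l) - r^2 * (a * 0 + b * exp (l * 0) / l))) {0..r}"
    using assms(3,4) by (intro fundamental_theorem_of_calculus)
      (auto intro!: derivative_eq_intros simp: field_simps simp flip: has_real_derivative_iff_has_vector_derivative)
  have int: "set_integrable lborel {0..r} ?f"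
    by (rule borel_integrable_compact[of "{0..r}", unfolded set_integrable_def[symmetric]])
      (auto intro!: continuous_intros)
  have eq: "mass g y r - mass g' y' r = 4 * pi * (LINT \<sigma>:{0..r}|lborel. \<sigma>^2 * g (y \<sigma>) - \<sigma>^2 * g' (y' \<sigma>))"
    by (subst set_integral_diff(2)[OF D.mass_integrable D'.mass_integrable]) (simp add: mass_def algebra_simps)
  have "\<bar>LINT \<sigma>:{0..r}|lborel. \<sigma>^2 * g (y \<sigma>) - \<sigma>^2 * g' (y' \<sigma>)\<bar> \<le>
      (LINT \<sigma>:{0..r}|lborel. \<bar>\<sigma>^2 * g (y \<sigma>) - \<sigma>^2 * g' (y' \<sigma>)\<bar>)"
    using set_integral_norm_bound[OF set_integral_diff(1)[OF D.mass_integrable D'.mass_integrable]]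
    by simp
  also have "\<dots> \<le> (LINT \<sigma>:{0..r}|lborel. ?f \<sigma>)"
  proof (rule set_integral_mono[OF set_integrable_abs[OF set_integral_diff(1)[OF D.mass_integrable D'.mass_integrable]] int])
    fix \<sigma> assume s: "\<sigma> \<in> {0..r}"
    have "\<bar>\<sigma>^2 * g (y \<sigma>) - \<sigma>^2 * g' (y' \<sigma>)\<bar> = \<sigma>^2 * \<bar>g (y \<sigma>) - g' (y' \<sigma>)\<bar>"
      by (simp add: abs_mult flip: right_diff_distrib)
    also have "\<dots> \<le> ?f \<sigma>"
      using s bd[of \<sigma>] by (intro mult_mono power_mono) auto
    finally show "\<bar>\<sigma>^2 * g (y \<sigma>) - \<sigma>^2 * g' (y' \<sigma>)\<bar> \<le> ?f \<sigma>" .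
  qed
  also have "\<dots> \<le> r^2 * (a * r + b * exp (l * r) / l)"
    unfolding set_borel_integral_eq_integral(2)[OF int] integral_unique[OF hi]
    using assms by (simp add: mult_left_mono algebra_simps)
  finally have "4 * pi * \<bar>LINT \<sigma>:{0..r}|lborel. \<sigma>^2 * g (y \<sigma>) - \<sigma>^2 * g' (y' \<sigma>)\<bar>
     \<le> 4 * pi * (r^2 * (a * r + b * exp (l * r) / l))"
    by (intro mult_left_mono) auto
  then show ?thesis
    by (simp add: eq abs_mult mult.assoc)
qed

text \<open>Both \<open>\<psi> - f\<close> and \<open>\<psi> + f\<close> are nondecreasing. With
  \<open>\<psi>\<close> an explicit antiderivative of the bound, this replaces integrating
  \<open>f'\<close>.\<close>

lemma abs_le_of_deriv_le:
  fixes f \<psi> :: "real \<Rightarrow> real"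
  assumes "a \<le> b" "continuous_on {a..b} f" "continuous_on {a..b} \<psi>"
    and "\<And>x. a < x \<Longrightarrow> x < b \<Longrightarrow> (f has_real_derivative f' x) (at x)"
    and "\<And>x. a < x \<Longrightarrow> x < b \<Longrightarrow> (\<psi> has_real_derivative \<psi>' x) (at x)"
    and "\<And>x. a < x \<Longrightarrow> x < b \<Longrightarrow> \<bar>f' x\<bar> \<le> \<psi>' x"
  shows "\<bar>f b - f a\<bar> \<le> \<psi> b - \<psi> a"
proof -
  have "\<psi> a - f a \<le> \<psi> b - f b"
    by (rule DERIV_nonneg_imp_increasing_open[OF assms(1), where f = "\<lambda>x. \<psi> x - f x"])
      (use assms in \<open>force intro!: derivative_eq_intros continuous_intros exI[of _ "\<psi>' _ - f' _"]\<close>)+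
  moreover have "\<psi> a + f a \<le> \<psi> b + f b"
    by (rule DERIV_nonneg_imp_increasing_open[OF assms(1), where f = "\<lambda>x. \<psi> x + f x"])
      (use assms in \<open>force intro!: derivative_eq_intros continuous_intros exI[of _ "\<psi>' _ + f' _"]\<close>)+
  ultimately show ?thesis
    by linarith
qed

section \<open>Comparison with the Newtonian solution\<close>

lemma factor_near_one:
  fixes u :: real
  assumes "0 \<le> u" "u \<le> 1/2"
  shows "\<bar>1 / (1 - u) - 1\<bar> \<le> 2 * u" "0 < 1 / (1 - u)" "1 / (1 - u) \<le> 2"
proof -
  have "1 / (1 - u) - 1 = u / (1 - u)"
    using assms by (simp add: field_simps)
  moreover have "u / (1 - u) \<le> u / (1 / 2)"
    using assms by (intro divide_left_mono) auto
  moreover have "0 \<le> u / (1 - u)"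
    using assms by simp
  ultimately show "\<bar>1 / (1 - u) - 1\<bar> \<le> 2 * u" "1 / (1 - u) \<le> 2"
    using assms by auto
qed (use assms in auto)

text \<open>The error splits into the mass difference, the deviation of the metric factor from 1
  times \<open>M / s^2\<close>, and the pressure term; the last two are of order \<kappa>. Being
  about numbers, the estimate serves on the compact interval and, with \<open>A = 0\<close>, in the
  vacuum beyond it.\<close>

lemma rhs_diff_le:
  fixes M m0 s \<kappa> h Q A :: real
  assumes "0 < s" "0 \<le> M" "M \<le> Q" "0 \<le> h" "h \<le> A" "0 \<le> \<kappa>" "2 * \<kappa> * M / s \<le> 1/2"
  shows "\<bar>- (1 / (1 - 2 * \<kappa> * M / s)) * (M / s^2 + 4 * pi * \<kappa> * s * h) + m0 / s^2\<bar>
      \<le> \<bar>M - m0\<bar> / s^2 + \<kappa> * (4 * Q^2 / s^3 + 8 * pi * A * s)"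
proof -
  define u where "u = 2 * \<kappa> * M / s"
  have u: "0 \<le> u" "u \<le> 1/2"
    using assms by (auto simp: u_def)
  note f = factor_near_one[OF u]
  have "- (1 / (1 - u)) * (M / s^2 + 4 * pi * \<kappa> * s * h) + m0 / s^2 =
     - ((M - m0) / s^2) - (1 / (1 - u) - 1) * (M / s^2) - 1 / (1 - u) * (4 * pi * \<kappa> * s * h)"
    by (simp add: algebra_simps diff_divide_distrib)
  also have "\<bar>\<dots>\<bar> \<le> \<bar>M - m0\<bar> / s^2 + \<bar>1 / (1 - u) - 1\<bar> * (M / s^2) + 1 / (1 - u) * (4 * pi * \<kappa> * s * h)"
  proof -
    have "\<bar>(1 / (1 - u) - 1) * (M / s^2)\<bar> = \<bar>1 / (1 - u) - 1\<bar> * (M / s^2)"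
      "\<bar>(M - m0) / s^2\<bar> = \<bar>M - m0\<bar> / s^2"
      using assms by (simp_all add: abs_mult)
    moreover have "0 \<le> 1 / (1 - u) * (4 * pi * \<kappa> * s * h)"
      using assms f by (intro mult_nonneg_nonneg) auto
    moreover have "\<bar>- a - b - c\<bar> \<le> \<bar>a\<bar> + \<bar>b\<bar> + c" if "0 \<le> c" for a b c :: real
      using that by linarith
    ultimately show ?thesis by metis
  qed
  also have "\<dots> \<le> \<bar>M - m0\<bar> / s^2 + 2 * u * (M / s^2) + 2 * (4 * pi * \<kappa> * s * A)"
    using assms f by (intro add_mono mult_mono) auto
  \<comment> \<open>The metric deviation is itself proportional to \<open>M / s\<close>, hence the
    square of the mass.\<close>
  also have "2 * u * (M / s^2) = \<kappa> * (4 * M^2 / s^3)"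
    by (simp add: u_def power2_eq_square power3_eq_cube mult_ac)
  also have "\<dots> \<le> \<kappa> * (4 * Q^2 / s^3)"
    using assms by (intro mult_left_mono divide_right_mono power_mono) auto
  finally show ?thesis
    by (simp add: u_def algebra_simps)
qed

text \<open>The bound on \<open>16 * pi * Q * S^2 * \<kappa>\<close> keeps
  \<open>2 * \<kappa> * mass g z s / s\<close> below 1/2. The exponential weight yields a
  contraction on an interval of any length \<open>S\<close>, so no subdivision is made.\<close>

lemma newton_limit_compact:
  fixes S c A Q \<kappa> \<epsilon> L :: real and z y g g0 h :: "real \<Rightarrow> real"
  assumes S: "0 < S" and L: "0 < L" and A: "0 \<le> A"
    and D: "bounded_density g z Q" and D0: "bounded_density g0 y Q"
    and \<kappa>: "0 < \<kappa>" "\<kappa> \<le> \<epsilon>" "16 * pi * Q * S^2 * \<kappa> \<le> 1"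
    and lip: "\<And>x x'. x \<le> 1 \<Longrightarrow> x' \<le> 1 \<Longrightarrow> \<bar>g0 x - g0 x'\<bar> \<le> L * \<bar>x - x'\<bar>"
    and close: "\<And>x. x \<le> 1 \<Longrightarrow> \<bar>g x - g0 x\<bar> \<le> A * \<epsilon>"
    and h: "\<And>x. x \<le> 1 \<Longrightarrow> 0 \<le> h x" "\<And>x. x \<le> 1 \<Longrightarrow> h x \<le> A"
    and init: "z 0 = y 0"
    and dz: "\<And>s. 0 < s \<Longrightarrow> (z has_real_derivative - (1 / (1 - 2 * \<kappa> * mass g z s / s)) *
          (mass g z s / s^2 + 4 * pi * \<kappa> * s * h (z s))) (at s)"
    and dy: "\<And>s. 0 < s \<Longrightarrow> (y has_real_derivative - mass g0 y s / s^2) (at s)"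
    and s: "0 \<le> s" "s \<le> S"
  shows "\<bar>z s - y s\<bar> \<le> 2 * S * (64 * pi^2 * Q^2 * S^3 + 12 * pi * A * S) * exp (sqrt (8 * pi * L) * S) * \<epsilon>"
proof -
  interpret D: bounded_density g z Q by fact
  interpret D0: bounded_density g0 y Q by fact
  define l where "l = sqrt (8 * pi * L)"
  \<comment> \<open>Three errors of order \<epsilon>: the metric factor contributes
    \<open>64 * pi^2 * Q^2 * S^3\<close>, the density error \<open>4 * pi * A * S\<close>, the
    pressure \<open>8 * pi * A * S\<close>.\<close>
  define K where "K = 64 * pi^2 * Q^2 * S^3 + 12 * pi * A * S"
  have l: "0 < l" "l^2 = 8 * pi * L"
    using L by (auto simp: l_def)
  have K: "0 \<le> K"
    using S A by (auto simp: K_def)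
  define e where "e s = z s - y s" for s
  have e_cont: "continuous_on {0..t} e" for t
    unfolding e_def
    by (intro continuous_on_diff continuous_on_subset[OF D.y_cont] continuous_on_subset[OF D0.y_cont]) auto
  have "\<exists>t\<in>{0..S}. \<forall>s\<in>{0..S}. \<bar>e s\<bar> * exp (- l * s) \<le> \<bar>e t\<bar> * exp (- l * t)"
    by (rule continuous_attains_sup) (use S in \<open>auto intro!: continuous_intros e_cont\<close>)
  then obtain t where t: "0 \<le> t" "t \<le> S"
    and tmax: "\<And>s. 0 \<le> s \<Longrightarrow> s \<le> S \<Longrightarrow> \<bar>e s\<bar> * exp (- l * s) \<le> \<bar>e t\<bar> * exp (- l * t)"
    by auto
  define N where "N = \<bar>e t\<bar> * exp (- l * t)"
    \<comment> \<open>the weighted norm of \<open>e\<close>; with \<open>l\<^sup>2 = 8 \<pi> L\<close> the two integrations contract it by \<open>1/2\<close>\<close>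
  have N: "0 \<le> N" "\<bar>e t\<bar> = N * exp (l * t)"
    by (auto simp: N_def mult.assoc simp flip: exp_add)
  have eN: "\<bar>e s\<bar> \<le> N * exp (l * s)" if "0 \<le> s" "s \<le> S" for s
    using tmax[OF that] by (simp add: N_def exp_minus field_simps)
  have bd: "\<bar>- (1 / (1 - 2 * \<kappa> * mass g z r / r)) *
          (mass g z r / r^2 + 4 * pi * \<kappa> * r * h (z r)) - (- mass g0 y r / r^2)\<bar>
      \<le> K * \<epsilon> + 4 * pi * L * N / l * exp (l * r)" if r: "0 < r" "r \<le> S" for r
  proof -
    have mQ: "mass g z r \<le> 4 * pi * Q * r^3"
      using D.mass_le r by simp
    have m0: "0 \<le> mass g z r"
      by (simp add: mass_nonneg D.g_nonneg)
    have "2 * \<kappa> * mass g z r / r \<le> 2 * \<kappa> * (4 * pi * Q * r^3) / r"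
      using r \<kappa> mQ by (intro divide_right_mono mult_left_mono) auto
    also have "\<dots> = 8 * pi * Q * r^2 * \<kappa>"
      using r by (simp add: power2_eq_square power3_eq_cube)
    also have "\<dots> \<le> 8 * pi * Q * S^2 * \<kappa>"
      using r \<kappa> D.A_nonneg by (intro mult_right_mono mult_left_mono power_mono) auto
    finally have u: "2 * \<kappa> * mass g z r / r \<le> 1/2"
      using \<kappa>(3) by linarith
    have "\<bar>mass g z r - mass g0 y r\<bar> \<le> 4 * pi * r^2 * (A * \<epsilon> * r + L * N * exp (l * r) / l)"
    proof (rule mass_diff_le[OF D D0])
      fix x assume x: "0 \<le> x" "x \<le> r"
      have "\<bar>g (z x) - g0 (y x)\<bar> \<le> \<bar>g (z x) - g0 (z x)\<bar> + \<bar>g0 (z x) - g0 (y x)\<bar>"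
        by linarith
      also have "\<dots> \<le> A * \<epsilon> + L * \<bar>z x - y x\<bar>"
        using x D.y_le D0.y_le by (intro add_mono close lip) auto
      also have "\<dots> \<le> A * \<epsilon> + L * (N * exp (l * x))"
        using x r eN[of x] L A by (intro add_mono mult_left_mono) (auto simp: e_def)
      finally show "\<bar>g (z x) - g0 (y x)\<bar> \<le> A * \<epsilon> + L * N * exp (l * x)"
        by (simp add: mult.assoc)
    qed (use r l A L N \<kappa> in auto)
    then have "\<bar>mass g z r - mass g0 y r\<bar> / r^2 \<le> 4 * pi * (A * \<epsilon> * r + L * N * exp (l * r) / l)"
      using r by (simp add: field_simps)
    also have "\<dots> \<le> 4 * pi * (A * \<epsilon> * S + L * N * exp (l * r) / l)"
      using r A \<kappa> by (intro mult_left_mono add_mono) auto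
    finally have m: "\<bar>mass g z r - mass g0 y r\<bar> / r^2 \<le> 4 * pi * A * S * \<epsilon> + 4 * pi * L * N / l * exp (l * r)"
      by (simp add: algebra_simps)
    \<comment> \<open>The cubic mass bound turns \<open>M^2 / r^3\<close> into a multiple of
      \<open>r^3\<close>, so the metric correction stays bounded at the centre.\<close>
    have "\<kappa> * (4 * (4 * pi * Q * r^3)^2 / r^3 + 8 * pi * A * r) \<le> \<epsilon> * (64 * pi^2 * Q^2 * S^3 + 8 * pi * A * S)"
    proof (intro mult_mono add_mono)
      have "4 * (4 * pi * Q * r^3)^2 / r^3 = 64 * pi^2 * Q^2 * r^3"
        using r by (simp add: field_simps power2_eq_square power3_eq_cube)
      also have "\<dots> \<le> 64 * pi^2 * Q^2 * S^3"
        using r by (intro mult_left_mono power_mono) auto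
      finally show "4 * (4 * pi * Q * r^3)^2 / r^3 \<le> 64 * pi^2 * Q^2 * S^3" .
    qed (use r A \<kappa> in auto)
    moreover have "4 * pi * A * S * \<epsilon> + \<epsilon> * (64 * pi^2 * Q^2 * S^3 + 8 * pi * A * S) = K * \<epsilon>"
      by (simp add: K_def algebra_simps)
    ultimately show ?thesis
      using rhs_diff_le[OF r(1) m0 mQ h(1)[OF D.y_le] h(2)[OF D.y_le] less_imp_le[OF \<kappa>(1)] u, of r "mass g0 y r"] m r
      by (simp del: power_mult_distrib)
  qed
  have e_le: "\<bar>e s\<bar> \<le> S * K * \<epsilon> + N / 2 * exp (l * s)" if s: "0 \<le> s" "s \<le> S" for s
  proof -
    have "\<bar>e s - e 0\<bar> \<le> (K * \<epsilon> * s + 4 * pi * L * N / l^2 * exp (l * s)) -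
       (K * \<epsilon> * 0 + 4 * pi * L * N / l^2 * exp (l * 0))"
    proof (rule abs_le_of_deriv_le[OF s(1) e_cont])
      fix x assume x: "0 < x" "x < s"
      show "(e has_real_derivative - (1 / (1 - 2 * \<kappa> * mass g z x / x)) *
          (mass g z x / x^2 + 4 * pi * \<kappa> * x * h (z x)) - (- mass g0 y x / x^2)) (at x)"
        unfolding e_def by (intro DERIV_diff dz dy x)
      show "((\<lambda>s. K * \<epsilon> * s + 4 * pi * L * N / l^2 * exp (l * s)) has_real_derivative
          K * \<epsilon> + 4 * pi * L * N / l * exp (l * x)) (at x)"
        using l(1) by (auto intro!: derivative_eq_intros simp: power2_eq_square)
    qed (use bd s l in \<open>auto intro!: continuous_intros\<close>)
    moreover have "4 * pi * L * N / l^2 = N / 2"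
      using L by (simp add: l(2))
    moreover have "K * \<epsilon> * s \<le> K * \<epsilon> * S"
      using s K \<kappa> by (intro mult_left_mono mult_nonneg_nonneg) auto
    then have "K * \<epsilon> * s \<le> S * K * \<epsilon>"
      by (simp add: mult_ac)
    ultimately show ?thesis
      using init N(1) by (simp add: e_def)
  qed
  have "N \<le> 2 * S * K * \<epsilon>"
  proof -
    \<comment> \<open>At the maximum point \<open>t\<close> the left side equals
      \<open>\<bar>e t\<bar>\<close>; the exponential term is half of it and is absorbed.\<close>
    have "N * exp (l * t) \<le> S * K * \<epsilon> + N / 2 * exp (l * t)"
      using e_le[OF t] N(2) by simp
    then have "N / 2 * exp (l * t) \<le> S * K * \<epsilon>"
      by simp
    moreover have "N / 2 * 1 \<le> N / 2 * exp (l * t)"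
      using N l t by (intro mult_left_mono) auto
    ultimately show ?thesis
      by linarith
  qed
  then have "N * exp (l * s) \<le> 2 * S * K * \<epsilon> * exp (l * S)"
    using N l s \<kappa> K S by (intro mult_mono) auto
  then show ?thesis
    using eN[OF s] by (simp add: e_def K_def l_def mult_ac)
qed

text \<open>A positive solution would satisfy both \<open>y \<ge> \<mu> / s\<close>, as the mass is at least \<open>\<mu>\<close>, and
  \<open>y' \<le> - const s y\<^sup>n\<close>, as \<open>y\<close> decreases; the latter gives \<open>y \<le> const s\<^bsup>-2/(n-1)\<^esup>\<close>, and
  \<open>2/(n-1) > 1\<close> for \<open>n < 3\<close>.\<close>

lemma newton_radius:
  fixes c n :: real and y :: "real \<Rightarrow> real"
  assumes D: "bounded_density (\<lambda>x. if x \<le> 0 then 0 else c * x powr n) y Q"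
    and c: "0 < c" and n: "1 < n" "n < 3" and init: "y 0 = 1"
    and dy: "\<And>s. 0 < s \<Longrightarrow>
      (y has_real_derivative - mass (\<lambda>x. if x \<le> 0 then 0 else c * x powr n) y s / s^2) (at s)"
  shows "\<exists>S>0. y S < 0"
proof (rule ccontr)
  assume "\<not> (\<exists>S>0. y S < 0)"
  then have y_nonneg: "0 \<le> y s" if "0 < s" for s
    using that by force
  define g where "g x = (if x \<le> 0 then 0 else c * x powr n)" for x :: real
  define m where "m = mass g y"
  interpret bounded_density g y Q
    using D by (simp add: g_def[abs_def])
  have dy: "(y has_real_derivative - m s / s^2) (at s)" if "0 < s" for s
    using dy[OF that] by (simp add: m_def g_def[abs_def])
  have m_nonneg: "0 \<le> m s" for s
    by (simp add: m_def mass_nonneg g_nonneg)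
  have y_decr: "y s \<le> y r" if "0 \<le> r" "r \<le> s" for r s
  proof (rule DERIV_nonpos_imp_decreasing_open[OF that(2)])
    fix x assume "r < x" "x < s"
    then show "\<exists>d. (y has_real_derivative d) (at x) \<and> d \<le> 0"
      using dy[of x] that m_nonneg[of x] by (intro exI[of _ "- m x / x^2"]) auto
  qed (use that in \<open>auto intro!: continuous_on_subset[OF y_cont]\<close>)
  have m_ge: "4 * pi / 3 * g (y s) * s^3 \<le> m s" if "0 \<le> s" for s
    unfolding m_def
  proof (rule mass_ge[OF that])
    fix r assume "0 \<le> r" "r \<le> s"
    then show "g (y s) \<le> g (y r)"
      using y_decr[of r s] c n by (auto simp: g_def intro!: mult_left_mono powr_mono2)
  qed (simp add: g_nonneg)
  have "((\<lambda>s. y s) \<longlongrightarrow> y 0) (at 0 within {0..})"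
    using y_cont by (simp add: continuous_on_def)
  then have "((\<lambda>s. y s) \<longlongrightarrow> 1) (at_right 0)"
    using init by (auto intro: tendsto_within_subset)
  then have "\<forall>\<^sub>F s in at_right 0. y s > 0"
    by (rule order_tendstoD) simp
  then obtain t where t: "0 < t" "0 < y t"
    by (metis eventually_at_right_field dense zero_less_one)
  \<comment> \<open>Matter inside radius \<open>t\<close> has positive mass, which bounds the mass
    from below at every larger radius.\<close>
  define \<mu> where "\<mu> = m t"
  have "0 < 4 * pi / 3 * g (y t) * t^3"
    using t c by (simp add: g_def)
  then have \<mu>: "0 < \<mu>"
    using m_ge[of t] t by (simp add: \<mu>_def)
  have lower: "\<mu> / s \<le> y s" if s: "t \<le> s" for s
  proof -
    \<comment> \<open>Since \<open>m \<ge> \<mu>\<close>, the function \<open>y - \<mu> / s\<close>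
      is nonincreasing; as \<open>y R \<ge> 0\<close>, letting \<open>R\<close> tend to infinity
      gives the lower bound.\<close>
    have "y R - \<mu> / R \<le> y s - \<mu> / s" if R: "s \<le> R" for R
    proof (rule DERIV_nonpos_imp_decreasing_open[OF R, where f = "\<lambda>s. y s - \<mu> / s"])
      fix x assume x: "s < x" "x < R"
      have "\<mu> \<le> m x"
        using x s t by (simp add: \<mu>_def m_def mass_mono)
      then have "- m x / x^2 + \<mu> / x^2 \<le> 0"
        by (simp add: field_simps divide_right_mono flip: add_divide_distrib)
      moreover have "((\<lambda>s. y s - \<mu> / s) has_real_derivative - m x / x^2 + \<mu> / x^2) (at x)"
        using x s t by (auto intro!: derivative_eq_intros dy simp: power2_eq_square)
      ultimately show "\<exists>d. ((\<lambda>s. y s - \<mu> / s) has_real_derivative d) (at x) \<and> d \<le> 0"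
        by blast
    qed (use s t in \<open>auto intro!: continuous_intros continuous_on_subset[OF y_cont]\<close>)
    then have "- \<mu> / R \<le> y s - \<mu> / s" if "s \<le> R" for R
      using y_nonneg[of R] that s t by force
    then have "\<forall>\<^sub>F R in at_top. - \<mu> / R \<le> y s - \<mu> / s"
      by (auto simp: eventually_at_top_linorder)
    moreover have "((\<lambda>R. - \<mu> / R) \<longlongrightarrow> 0) at_top"
      by real_asymp
    ultimately have "0 \<le> y s - \<mu> / s"
      using trivial_limit_at_top_linorder by (intro tendsto_upperbound)
    then show ?thesis by simp
  qed
  have y_pos: "0 < y s" if "t \<le> s" for s
    using lower[OF that] \<mu> t that by (smt (verit) divide_pos_pos)
  \<comment> \<open>The lower bound \<open>m_ge\<close> makes the derivative of
    \<open>y powr (1 - n)\<close> at least \<open>2 * d * x\<close>, the derivative of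
    \<open>d * x^2\<close>.\<close>
  define d where "d = (n - 1) * (4 * pi / 3 * c) / 2"
  have d: "0 < d"
    using n c by (simp add: d_def)
  have upper: "d * (s^2 - t^2) \<le> \<mu> powr (1 - n) * s powr (n - 1)" if s: "t \<le> s" for s
  proof -
    have "y t powr (1 - n) - d * t^2 \<le> y s powr (1 - n) - d * s^2"
    proof (rule DERIV_nonneg_imp_increasing_open[OF s, where f = "\<lambda>s. y s powr (1 - n) - d * s^2"])
      fix x assume x: "t < x" "x < s"
      have yx: "0 < y x"
        using y_pos x by simp
      have "4 * pi / 3 * c * x * y x powr n \<le> m x / x^2"
        using m_ge[of x] x t yx by (simp add: g_def field_simps power2_eq_square power3_eq_cube)
      then have "4 * pi / 3 * c * x * y x powr n * y x powr (- n) \<le> m x / x^2 * y x powr (- n)"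
        by (intro mult_right_mono) auto
      then have "4 * pi / 3 * c * x \<le> m x / x^2 * y x powr (- n)"
        using yx by (simp add: mult.assoc flip: powr_add)
      then have "(n - 1) * (4 * pi / 3 * c * x) \<le> (n - 1) * (m x / x^2 * y x powr (- n))"
        using n by (intro mult_left_mono) auto
      moreover have "(1 - n) * y x powr (- n) * (- m x / x^2) - d * (2 * x) =
          (n - 1) * (m x / x^2 * y x powr (- n)) - (n - 1) * (4 * pi / 3 * c * x)"
        by (simp add: d_def algebra_simps diff_divide_distrib)
      ultimately have "0 \<le> (1 - n) * y x powr (- n) * (- m x / x^2) - d * (2 * x)"
        by linarith
      moreover have "((\<lambda>s. y s powr (1 - n) - d * s^2) has_real_derivative
          (1 - n) * y x powr (- n) * (- m x / x^2) - d * (2 * x)) (at x)"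
        using DERIV_diff[OF DERIV_fun_powr[OF dy yx, of "1 - n"] DERIV_cmult[OF DERIV_power[OF DERIV_ident, of 2], of d]] x t
        by simp
      ultimately show "\<exists>d'. ((\<lambda>s. y s powr (1 - n) - d * s^2) has_real_derivative d') (at x) \<and> 0 \<le> d'"
        by blast
    qed (use t y_pos s in \<open>force intro!: continuous_intros continuous_on_subset[OF y_cont]\<close>)
    moreover have "0 \<le> y t powr (1 - n)"
      by simp
    moreover have "y s powr (1 - n) \<le> (\<mu> / s) powr (1 - n)"
      using lower[OF s] \<mu> t s n by (intro powr_mono2') auto
    moreover have "(\<mu> / s) powr (1 - n) = \<mu> powr (1 - n) * s powr (n - 1)"
    proof -
      have "(\<mu> / s) powr (1 - n) = \<mu> powr (1 - n) / s powr (1 - n)"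
        using \<mu> t s by (simp add: powr_divide)
      also have "s powr (1 - n) = 1 / s powr (n - 1)"
        using powr_minus_divide[of s "n - 1"] by simp
      finally show ?thesis by simp
    qed
    ultimately show ?thesis
      unfolding right_diff_distrib by linarith
  qed
  \<comment> \<open>After division of \<open>upper\<close> by \<open>s^2\<close> the left side tends
    to \<open>d > 0\<close>, while the right side is a multiple of \<open>s powr (n - 3)\<close> and
    vanishes because \<open>n < 3\<close>.\<close>
  have "((\<lambda>s. (s^2 - t^2) / s^2) \<longlongrightarrow> 1) at_top"
    by real_asymp
  then have 1: "((\<lambda>s. d * ((s^2 - t^2) / s^2)) \<longlongrightarrow> d * 1) at_top"
    by (intro tendsto_intros)
  have "((\<lambda>s::real. s powr (n - 3)) \<longlongrightarrow> 0) at_top"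
    using n by (intro tendsto_neg_powr filterlim_ident) auto
  then have 2: "((\<lambda>s. \<mu> powr (1 - n) * s powr (n - 3)) \<longlongrightarrow> \<mu> powr (1 - n) * 0) at_top"
    by (intro tendsto_intros)
  have "\<forall>\<^sub>F s in at_top. d * ((s^2 - t^2) / s^2) \<le> \<mu> powr (1 - n) * s powr (n - 3)"
    using eventually_ge_at_top[of t]
  proof eventually_elim
    case (elim s)
    have "s powr (n - 3) = s powr (n - 1) / s^2"
      using elim t powr_diff[of s "n - 1" 2] by (simp add: powr_numeral)
    then show ?case
      using divide_right_mono[OF upper[OF elim], of "s^2"] by simp
  qed
  from tendsto_le[OF _ 2 1 this] d show False
    by simp
qed

section \<open>Lipschitz continuity of power-law densities\<close>

lemma powr_diff_le:
  fixes x y n :: real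
  assumes "0 \<le> y" "y \<le> x" "x \<le> b" "1 \<le> n"
  shows "x powr n - y powr n \<le> n * b powr (n - 1) * (x - y)"
proof (cases "y = x")
  case False
  have "\<bar>x powr n - y powr n\<bar> \<le> n * b powr (n - 1) * x - n * b powr (n - 1) * y"
  proof (rule abs_le_of_deriv_le[OF assms(2)])
    fix r assume r: "y < r" "r < x"
    show "((\<lambda>x. x powr n) has_real_derivative n * r powr (n - 1)) (at r)"
      using r assms by (auto intro!: derivative_eq_intros)
    show "((\<lambda>x. n * b powr (n - 1) * x) has_real_derivative n * b powr (n - 1)) (at r)"
      by (auto intro!: derivative_eq_intros)
    show "\<bar>n * r powr (n - 1)\<bar> \<le> n * b powr (n - 1)"
      using r assms by (auto simp: abs_mult intro!: powr_mono2)
  qed (use assms in \<open>auto intro!: continuous_intros continuous_on_powr'\<close>)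
  then show ?thesis
    by (simp add: algebra_simps)
qed simp

text \<open>Truncation to the positive part is 1-Lipschitz and the power has slope at most
  \<open>n\<close> on \<open>{0..1}\<close>; \<open>n \<ge> 1\<close> keeps the slope bounded at the
  vacuum boundary.\<close>

lemma polytrope_lipschitz:
  fixes c n x y :: real
  assumes "0 \<le> c" "1 \<le> n" "x \<le> 1" "y \<le> 1"
  shows "\<bar>(if x \<le> 0 then 0 else c * x powr n) - (if y \<le> 0 then 0 else c * y powr n)\<bar> \<le> c * n * \<bar>x - y\<bar>"
proof -
  have *: "\<bar>c * (max x 0) powr n - c * (max y 0) powr n\<bar> \<le> c * n * \<bar>x - y\<bar>"
    if "y \<le> x" "x \<le> 1" for x y
  proof -
    have "(max x 0) powr n - (max y 0) powr n \<le> n * 1 powr (n - 1) * (max x 0 - max y 0)"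
      using that assms by (intro powr_diff_le) auto
    also have "\<dots> \<le> n * (x - y)"
      using that assms by auto
    finally have "c * ((max x 0) powr n - (max y 0) powr n) \<le> c * (n * (x - y))"
      using assms by (intro mult_left_mono)
    moreover have "(max y 0) powr n \<le> (max x 0) powr n"
      using that assms by (intro powr_mono2) auto
    then have "c * (max y 0) powr n \<le> c * (max x 0) powr n"
      using assms by (intro mult_left_mono)
    ultimately show ?thesis
      using that by (simp add: algebra_simps)
  qed
  have eq: "(if x \<le> 0 then 0 else c * x powr n) = c * (max x 0) powr n" for x
    by auto
  show ?thesis
    unfolding eq using *[of x y] *[of y x] assms by (cases "x \<le> y") (auto simp: abs_minus_commute)
qed

text \<open>The rescaled relativistic problem in abstract form. The relativistic corrections have
  size \<kappa>, whereas the density error \<epsilon> may be larger: it will be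
  \<open>\<kappa> powr d\<close> with \<open>d \<le> 1\<close>.\<close>

locale perturbed_newton = bounded_density g z Q
  for g z :: "real \<Rightarrow> real" and Q :: real +
  fixes g0 h :: "real \<Rightarrow> real" and \<kappa> \<epsilon> A :: real
  assumes \<kappa>: "0 < \<kappa>" "\<kappa> \<le> \<epsilon>"
    and close: "\<And>x. x \<le> 1 \<Longrightarrow> \<bar>g x - g0 x\<bar> \<le> A * \<epsilon>"
    and vac: "\<And>x. x \<le> 0 \<Longrightarrow> g x = 0" "\<And>x. x \<le> 0 \<Longrightarrow> h x = 0"
    and h: "\<And>x. 0 \<le> h x" "\<And>x. x \<le> 1 \<Longrightarrow> h x \<le> A"
    and z0: "z 0 = 1"
    and pos: "\<And>s. 0 < s \<Longrightarrow> 0 < 1 - 2 * \<kappa> * mass g z s / s"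
    and dz: "\<And>s. 0 < s \<Longrightarrow> (z has_real_derivative - (1 / (1 - 2 * \<kappa> * mass g z s / s)) *
          (mass g z s / s^2 + 4 * pi * \<kappa> * s * h (z s))) (at s)"

text \<open>\<open>C\<close> and \<open>\<epsilon>\<^sub>0\<close> are fixed before the perturbed
  problem, which makes the estimate uniform in \<kappa>. It is global because past the Newtonian
  zero both masses are frozen and the integral of \<open>K' * \<epsilon> / r^2\<close> over all
  radii beyond \<open>S\<close> is at most \<open>K' * \<epsilon> / S\<close>.\<close>

lemma newton_limit:
  fixes c n A Q :: real and y g0 :: "real \<Rightarrow> real"
  assumes g0_def: "g0 = (\<lambda>x. if x \<le> 0 then 0 else c * x powr n)"
    and D0: "bounded_density g0 y Q"
    and c: "0 < c" and n: "1 < n" "n < 3" and A: "0 \<le> A" and init: "y 0 = 1"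
    and dy: "\<And>s. 0 < s \<Longrightarrow> (y has_real_derivative - mass g0 y s / s^2) (at s)"
  shows "\<exists>C>0. \<exists>\<epsilon>\<^sub>0>0. \<forall>g z h \<kappa> \<epsilon> s. perturbed_newton g z Q g0 h \<kappa> \<epsilon> A \<longrightarrow> \<epsilon> \<le> \<epsilon>\<^sub>0 \<longrightarrow> 0 \<le> s \<longrightarrow>
           \<bar>z s - y s\<bar> \<le> C * \<epsilon>"
proof -
  interpret D0: bounded_density g0 y Q
    by fact
  obtain S where S: "0 < S" "y S < 0"
    using newton_radius[OF D0[unfolded g0_def] c n init dy[unfolded g0_def]] by blast
  define L where "L = c * n"
  have L: "0 < L"
    using c n by (simp add: L_def)
  have lip: "\<bar>g0 x - g0 x'\<bar> \<le> L * \<bar>x - x'\<bar>" if "x \<le> 1" "x' \<le> 1" for x x'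
    using polytrope_lipschitz[of c n x x'] c n that by (simp add: g0_def L_def)
  define K where "K = 2 * S * (64 * pi^2 * Q^2 * S^3 + 12 * pi * A * S) * exp (sqrt (8 * pi * L) * S)"
  define q where "q = 4 * pi * Q * S^3"
  \<comment> \<open>The first summand bounds the mass difference at \<open>S\<close>, the second the
    metric correction, whose \<open>r^3\<close> in the denominator is estimated by
    \<open>S * r^2\<close>.\<close>
  define K' where "K' = 4 * pi * S^2 * ((A + L * K) * S) + 4 * q^2 / S"
  have K: "0 \<le> K"
    using S A by (auto simp: K_def)
  have K': "0 \<le> K'"
    using S A L K by (auto simp: K'_def)
  define C where "C = K + K' / S + 1"
  \<comment> \<open>The first entry gives the smallness condition of the compact estimate. The
    second makes \<open>K * \<epsilon>\<close> smaller than \<open>- y S\<close>, so that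
    \<open>z S\<close> is negative as well. Adding 1 keeps the denominators positive.\<close>
  define \<epsilon>\<^sub>0 where "\<epsilon>\<^sub>0 = min (1 / (16 * pi * Q * S^2 + 1)) (- y S / (K + 1))"
  have C: "0 < C"
    using K K' S by (auto simp: C_def intro: add_nonneg_pos)
  have "0 < - y S / (K + 1)"
    using K S by (intro divide_pos_pos) auto
  then have \<epsilon>\<^sub>0: "0 < \<epsilon>\<^sub>0"
    using K S D0.A_nonneg by (auto simp: \<epsilon>\<^sub>0_def intro!: divide_pos_pos add_nonneg_pos)
  have bound: "\<bar>z s - y s\<bar> \<le> C * \<epsilon>"
    if P: "perturbed_newton g z Q g0 h \<kappa> \<epsilon> A" and small: "\<epsilon> \<le> \<epsilon>\<^sub>0" and s: "0 \<le> s"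
    for g z h \<kappa> \<epsilon> s
  proof -
    interpret D: perturbed_newton g z Q g0 h \<kappa> \<epsilon> A by fact
    note \<kappa> = D.\<kappa> small and close = D.close and vac = D.vac and h = D.h and pos = D.pos and dz = D.dz
    have D: "bounded_density g z Q" by unfold_locales
    have \<epsilon>: "0 < \<epsilon>"
      using \<kappa> by simp
    have \<kappa>_le: "16 * pi * Q * S^2 * \<kappa> \<le> 1"
    proof -
      have "(16 * pi * Q * S^2 + 1) * \<kappa> \<le> (16 * pi * Q * S^2 + 1) * (1 / (16 * pi * Q * S^2 + 1))"
        using \<kappa> D0.A_nonneg by (intro mult_left_mono) (auto simp: \<epsilon>\<^sub>0_def)
      also have "\<dots> = 1"
        using D0.A_nonneg by (simp add: add_nonneg_eq_0_iff)
      finally show ?thesis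
        using \<kappa> by (simp add: algebra_simps)
    qed
    have inner: "\<bar>z s - y s\<bar> \<le> K * \<epsilon>" if "0 \<le> s" "s \<le> S" for s
      unfolding K_def
      by (rule newton_limit_compact[OF S(1) L A D D0.bounded_density_axioms \<kappa>(1,2) \<kappa>_le lip close h(1) h(2) _ dz dy that])
        (use init D.z0 in auto)
    have rest: "K * \<epsilon> \<le> C * \<epsilon>"
      using \<epsilon> K' S by (intro mult_right_mono) (auto simp: C_def)
    show ?thesis
    proof (cases "s \<le> S")
      case True
      then show ?thesis
        using inner[OF s] rest by linarith
    next
      case False
      have m_nonneg: "0 \<le> mass g z r" "0 \<le> mass g0 y r" for r
        by (simp_all add: mass_nonneg D.g_nonneg D0.g_nonneg)
      have z_decr: "z r \<le> z S" if "S \<le> r" for r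
      proof (rule DERIV_nonpos_imp_decreasing_open[OF that])
        fix x assume x: "S < x" "x < r"
        have "0 \<le> 1 / (1 - 2 * \<kappa> * mass g z x / x) * (mass g z x / x^2 + 4 * pi * \<kappa> * x * h (z x))"
          using x S \<kappa> pos[of x] h m_nonneg by (intro mult_nonneg_nonneg add_nonneg_nonneg) auto
        then have "- (1 / (1 - 2 * \<kappa> * mass g z x / x)) * (mass g z x / x^2 + 4 * pi * \<kappa> * x * h (z x)) \<le> 0"
          by simp
        moreover have "0 < x"
          using x S by simp
        ultimately show "\<exists>d. (z has_real_derivative d) (at x) \<and> d \<le> 0"
          using dz by blast
      qed (use S in \<open>auto intro!: continuous_on_subset[OF D.y_cont]\<close>)
      have y_decr: "y r \<le> y S" if "S \<le> r" for r
      proof (rule DERIV_nonpos_imp_decreasing_open[OF that])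
        fix x assume x: "S < x" "x < r"
        then show "\<exists>d. (y has_real_derivative d) (at x) \<and> d \<le> 0"
          using dy[of x] S m_nonneg(2)[of x] by (intro exI[of _ "- mass g0 y x / x^2"]) auto
      qed (use S in \<open>auto intro!: continuous_on_subset[OF D0.y_cont]\<close>)
      have "K * \<epsilon> \<le> K * (- y S / (K + 1))"
        using \<kappa> K by (intro mult_left_mono) (auto simp: \<epsilon>\<^sub>0_def)
      also have "\<dots> < (K + 1) * (- y S / (K + 1))"
        using K \<open>0 < - y S / (K + 1)\<close> by (intro mult_strict_right_mono) linarith+
      also have "\<dots> = - y S"
        using K by simp
      finally have zS: "z S \<le> 0"
        using inner[of S] S by auto
      have mass_z: "mass g z r = mass g z S" if "S \<le> r" for r
        by (rule D.mass_eq_vacuum) (use that S vac z_decr zS in force)+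
      have mass_y: "mass g0 y r = mass g0 y S" if "S \<le> r" for r
        by (rule D0.mass_eq_vacuum) (use that S y_decr in \<open>force simp: g0_def\<close>)+
      \<comment> \<open>The compact estimate is already uniform on \<open>{0..S}\<close>, so the
        exponential part enters with coefficient 0 and an arbitrary rate 1.\<close>
      have "\<bar>mass g z S - mass g0 y S\<bar> \<le> 4 * pi * S^2 * ((A * \<epsilon> + L * (K * \<epsilon>)) * S + 0 * exp (1 * S) / 1)"
      proof (rule mass_diff_le[OF D D0.bounded_density_axioms])
        fix x assume x: "0 \<le> x" "x \<le> S"
        have "\<bar>g (z x) - g0 (y x)\<bar> \<le> \<bar>g (z x) - g0 (z x)\<bar> + \<bar>g0 (z x) - g0 (y x)\<bar>"
          by linarith
        also have "\<dots> \<le> A * \<epsilon> + L * \<bar>z x - y x\<bar>"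
          using x D.y_le D0.y_le by (intro add_mono close lip) auto
        also have "\<dots> \<le> A * \<epsilon> + L * (K * \<epsilon>)"
          using x inner[of x] L A by (intro add_mono mult_left_mono) auto
        finally show "\<bar>g (z x) - g0 (y x)\<bar> \<le> A * \<epsilon> + L * (K * \<epsilon>) + 0 * exp (1 * x)"
          by simp
      qed (use S A K L \<epsilon> in auto)
      then have m_diff: "\<bar>mass g z S - mass g0 y S\<bar> \<le> 4 * pi * S^2 * ((A + L * K) * S) * \<epsilon>"
        by (simp add: algebra_simps)
      have bd: "\<bar>- (1 / (1 - 2 * \<kappa> * mass g z r / r)) *
          (mass g z r / r^2 + 4 * pi * \<kappa> * r * h (z r)) - (- mass g0 y r / r^2)\<bar> \<le> K' * \<epsilon> / r^2"
        if r: "S < r" for r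
      proof -
        have M: "mass g z r \<le> q"
          using D.mass_le[of S] S mass_z[of r] r by (simp add: q_def)
        have "2 * \<kappa> * mass g z r / r \<le> 2 * \<kappa> * q / S"
          using r S \<kappa> M m_nonneg(1)[of r] by (intro frac_le mult_left_mono) (auto simp: q_def D.A_nonneg)
        also have "\<dots> \<le> 1/2"
          using \<kappa>_le S by (simp add: q_def power2_eq_square power3_eq_cube algebra_simps)
        finally have u: "2 * \<kappa> * mass g z r / r \<le> 1/2" .
        have hr: "h (z r) = 0"
          using vac z_decr[of r] zS r by simp
        \<comment> \<open>In vacuum the pressure vanishes, so its bound is taken as 0; otherwise the
          term linear in \<open>r\<close> would not be integrable.\<close>
        have "\<kappa> * (4 * q^2 / r^3 + 8 * pi * 0 * r) \<le> \<epsilon> * (4 * q^2 / (S * r^2))"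
        proof (intro mult_mono)
          have "S * r^2 \<le> r^3"
            using r S by (simp add: power2_eq_square power3_eq_cube mult_right_mono)
          then show "4 * q^2 / r^3 + 8 * pi * 0 * r \<le> 4 * q^2 / (S * r^2)"
            using r S by (auto intro!: divide_left_mono)
        qed (use \<kappa> r S in auto)
        moreover have "\<bar>mass g z r - mass g0 y r\<bar> / r^2 \<le> 4 * pi * S^2 * ((A + L * K) * S) * \<epsilon> / r^2"
          using m_diff mass_z[of r] mass_y[of r] r by (intro divide_right_mono) auto
        moreover have "\<bar>- (1 / (1 - 2 * \<kappa> * mass g z r / r)) *
          (mass g z r / r^2 + 4 * pi * \<kappa> * r * h (z r)) + mass g0 y r / r^2\<bar>
           \<le> \<bar>mass g z r - mass g0 y r\<bar> / r^2 + \<kappa> * (4 * q^2 / r^3 + 8 * pi * 0 * r)"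
          by (rule rhs_diff_le) (use r S M m_nonneg hr u \<kappa> in auto)
        moreover have "4 * pi * S^2 * ((A + L * K) * S) * \<epsilon> / r^2 + \<epsilon> * (4 * q^2 / (S * r^2)) = K' * \<epsilon> / r^2"
          using S r by (simp add: K'_def field_simps)
        ultimately show ?thesis
          by simp
      qed
      have Ss: "S \<le> s"
        using False by simp
      have "\<bar>(z s - y s) - (z S - y S)\<bar> \<le> - (K' * \<epsilon>) / s - (- (K' * \<epsilon>) / S)"
      proof (rule abs_le_of_deriv_le[OF Ss, where f = "\<lambda>x. z x - y x" and \<psi> = "\<lambda>x. - (K' * \<epsilon>) / x"])
        fix x assume x: "S < x" "x < s"
        show "((\<lambda>x. z x - y x) has_real_derivative - (1 / (1 - 2 * \<kappa> * mass g z x / x)) *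
          (mass g z x / x^2 + 4 * pi * \<kappa> * x * h (z x)) - (- mass g0 y x / x^2)) (at x)"
          using x S by (intro DERIV_diff dz dy) auto
        show "((\<lambda>x. - (K' * \<epsilon>) / x) has_real_derivative K' * \<epsilon> / x^2) (at x)"
          using x S by (auto intro!: derivative_eq_intros simp: power2_eq_square)
      qed (use bd S in \<open>auto intro!: continuous_intros continuous_on_subset[OF D.y_cont] continuous_on_subset[OF D0.y_cont]\<close>)
      moreover have "0 \<le> K' * \<epsilon> / s"
        using K' \<epsilon> s by simp
      moreover have "C * \<epsilon> = K * \<epsilon> + K' * \<epsilon> / S + \<epsilon>"
        by (simp add: C_def algebra_simps)
      ultimately show ?thesis
        using inner[of S] S \<epsilon> by auto
    qed
  qed
  then show ?thesis
    using C \<epsilon>\<^sub>0 by blast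
qed

section \<open>Expansion of the equation of state\<close>

lemma abs_set_integral_le:
  fixes f :: "real \<Rightarrow> real"
  assumes "set_borel_measurable borel {a..b} f" "\<And>x. x \<in> {a..b} \<Longrightarrow> \<bar>f x\<bar> \<le> B" "a \<le> b"
  shows "\<bar>set_lebesgue_integral lborel {a..b} f\<bar> \<le> B * (b - a)"
proof -
  have "\<bar>set_lebesgue_integral lborel {a..b} f\<bar> \<le> (LINT x:{a..b}|lborel. \<bar>f x\<bar>)"
    using set_integral_norm_bound[OF set_integrable_bounded_interval[OF assms(1,2)]] by simp
  also have "\<dots> \<le> (LINT x:{a..b}|lborel. B)"
    by (rule set_integral_mono[OF set_integrable_abs[OF set_integrable_bounded_interval[OF assms(1,2)]]])
      (use assms in \<open>auto intro!: set_integrable_bounded_interval[where B = "\<bar>B\<bar>"] simp: set_borel_measurable_def\<close>)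
  also have "\<dots> = B * (b - a)"
    using assms(3) by (simp add: set_lebesgue_integral_def)
  finally show ?thesis .
qed

section \<open>Measurability, sign and null-set invariance of the equation of state\<close>

lemma g_rel_measurable:
  assumes [measurable]: "\<Phi> \<in> borel_measurable borel"
  shows "g_rel \<Phi> \<in> borel_measurable borel"
proof -
  \<comment> \<open>The domain of integration depends on \<open>y\<close>; written as a condition in
    the integrand, it becomes jointly measurable in \<open>y\<close> and \<eta>.\<close>
  have "g_rel \<Phi> y = (if y \<le> 0 then 0 else 4 * pi * exp (3 * y) *
      (LINT \<eta>|lborel. (if 0 \<le> \<eta> \<and> \<eta> \<le> 1 - exp (- y) then
        \<Phi> \<eta> * (1 - \<eta>)^2 * sqrt (exp (2 * y) * (1 - \<eta>)^2 - 1) else 0)))" for y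
    unfolding g_rel_def set_lebesgue_integral_def
    by (intro if_cong refl arg_cong2[where f = "(*)"] Bochner_Integration.integral_cong) (auto simp: indicator_def)
  then show ?thesis
    by (subst measurable_cong) (assumption, measurable)
qed

text \<open>A single point is a null set. This matters since the asymptotic condition at the right
  of 0 leaves \<open>\<Phi> 0\<close> free.\<close>

lemma set_integral_cong_except_0:
  fixes f g :: "real \<Rightarrow> real"
  assumes [measurable]: "f \<in> borel_measurable borel" "g \<in> borel_measurable borel"
    and "\<And>x. x \<noteq> 0 \<Longrightarrow> f x = g x"
  shows "set_lebesgue_integral lborel {a..b} f = set_lebesgue_integral lborel {a..b} g"
  unfolding set_lebesgue_integral_def
proof (rule integral_cong_AE)
  show "AE x in lborel. indicator {a..b} x *\<^sub>R f x = indicator {a..b} x *\<^sub>R g x"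
    using AE_lborel_singleton[of 0] by eventually_elim (simp add: assms)
qed measurable

lemma g_rel_cong:
  assumes [measurable]: "\<Phi> \<in> borel_measurable borel" "\<Psi> \<in> borel_measurable borel"
    and "\<And>x. x \<noteq> 0 \<Longrightarrow> \<Phi> x = \<Psi> x"
  shows "g_rel \<Phi> = g_rel \<Psi>"
  unfolding g_rel_def using assms(3)
  by (intro ext if_cong refl arg_cong2[where f = "(*)"] set_integral_cong_except_0) simp_all

lemma P_rel_cong:
  assumes [measurable]: "\<Phi> \<in> borel_measurable borel" "\<Psi> \<in> borel_measurable borel"
    and "\<And>x. x \<noteq> 0 \<Longrightarrow> \<Phi> x = \<Psi> x"
  shows "P_rel \<Phi> = P_rel \<Psi>"
  unfolding P_rel_def using assms(3)
  by (intro ext if_cong refl arg_cong2[where f = "(*)"] set_integral_cong_except_0) simp_all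

lemma g_rel_nonneg:
  assumes "\<And>\<eta>. 0 \<le> \<Phi> \<eta>"
  shows "0 \<le> g_rel \<Phi> y"
proof -
  \<comment> \<open>\<open>sqrt\<close> is odd and thus negative on negative arguments, so the
    radicand must be checked on the domain of integration; \<open>powr\<close> in the pressure is
    nonnegative anyway.\<close>
  have "0 \<le> exp (2 * y) * (1 - \<eta>)^2 - 1" if "\<eta> \<le> 1 - exp (- y)" for \<eta>
  proof -
    have "exp (- y)^2 \<le> (1 - \<eta>)^2"
      using that by (intro power_mono) auto
    then have "exp (2 * y) * exp (- y)^2 \<le> exp (2 * y) * (1 - \<eta>)^2"
      by (intro mult_left_mono) auto
    then show ?thesis
      by (simp flip: exp_add exp_of_nat_mult)
  qed
  then show ?thesis
    using assms by (auto simp: g_rel_def intro!: mult_nonneg_nonneg set_integral_nonneg_on)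
qed

lemma P_rel_nonneg:
  assumes "\<And>\<eta>. 0 \<le> \<Phi> \<eta>"
  shows "0 \<le> P_rel \<Phi> y"
  using assms by (auto simp: P_rel_def intro!: mult_nonneg_nonneg set_integral_nonneg_on)

section \<open>The Newtonian density as a pure power\<close>

text \<open>Substituting \<open>\<eta> = x * t\<close> pulls out \<open>x powr k\<close> from the
  profile, \<open>sqrt x\<close> from the kernel and \<open>x\<close> from the measure.\<close>

lemma g_newt_eq:
  assumes "0 < k"
  shows "g_newt C k x = (if x \<le> 0 then 0 else g_newt C k 1 * x powr (k + 3/2))"
proof (cases "x \<le> 0")
  case False
  then have x: "0 < x" by simp
  have "(LINT \<eta>:{0..x}|lborel. Phi0 C k \<eta> * sqrt (x - \<eta>)) =
      \<bar>x\<bar> *\<^sub>R (LINT t|lborel. indicator {0..x} (0 + x * t) *\<^sub>R (Phi0 C k (0 + x * t) * sqrt (x - (0 + x * t))))"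
    unfolding set_lebesgue_integral_def using x by (intro lborel_integral_real_affine) simp
  also have "(\<lambda>t. indicator {0..x} (0 + x * t) *\<^sub>R (Phi0 C k (0 + x * t) * sqrt (x - (0 + x * t)))) =
      (\<lambda>t. (x powr k * sqrt x) * (indicator {0..1} t *\<^sub>R (Phi0 C k t * sqrt (1 - t))))"
  proof
    fix t
    have "sqrt (x - x * t) = sqrt x * sqrt (1 - t)"
      by (simp add: algebra_simps flip: real_sqrt_mult)
    moreover have "indicator {0..x} (x * t) = indicat_real {0..1} t"
      using x by (auto simp: indicator_def zero_le_mult_iff)
    moreover have "Phi0 C k (x * t) = x powr k * Phi0 C k t"
      using x by (auto simp: Phi0_def powr_mult zero_less_mult_iff)
    ultimately show "indicator {0..x} (0 + x * t) *\<^sub>R (Phi0 C k (0 + x * t) * sqrt (x - (0 + x * t))) =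
      (x powr k * sqrt x) * (indicator {0..1} t *\<^sub>R (Phi0 C k t * sqrt (1 - t)))"
      by simp
  qed
  also have "\<bar>x\<bar> *\<^sub>R (LINT t|lborel. (x powr k * sqrt x) * (indicator {0..1} t *\<^sub>R (Phi0 C k t * sqrt (1 - t)))) =
      x powr (k + 3/2) * (LINT \<eta>:{0..1}|lborel. Phi0 C k \<eta> * sqrt (1 - \<eta>))"
  proof -
    have "x powr (k + 3/2) = x powr (1 + k + 1/2)"
      by (simp add: add.commute)
    also have "\<dots> = x * x powr k * sqrt x"
      using x by (simp only: powr_add powr_half_sqrt powr_one)
    finally show ?thesis
      using x by (simp add: set_lebesgue_integral_def mult_ac)
  qed
  finally show ?thesis
    using x by (simp add: g_newt_def)
qed (simp add: g_newt_def)

lemma g_newt_integrable: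
  assumes "0 < k"
  shows "set_integrable lborel {0..z} (\<lambda>\<eta>. Phi0 C k \<eta> * sqrt (z - \<eta>))"
proof (rule set_integrable_bounded_interval)
  show "set_borel_measurable borel {0..z} (\<lambda>\<eta>. Phi0 C k \<eta> * sqrt (z - \<eta>))"
    unfolding set_borel_measurable_def Phi0_def by measurable
  show "\<bar>Phi0 C k \<eta> * sqrt (z - \<eta>)\<bar> \<le> (\<bar>C\<bar> * z powr k) * sqrt z" if "\<eta> \<in> {0..z}" for \<eta>
    using that assms by (auto simp: Phi0_def abs_mult intro!: mult_mono powr_mono2)
qed

lemma g_newt_1_pos:
  assumes "0 < k" "0 < C"
  shows "0 < g_newt C k 1"
proof -
  \<comment> \<open>On this subinterval \<eta> is at least 1/4 and \<open>1 - \<eta>\<close> at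
    least 1/2, so the integrand stays above a positive constant.\<close>
  let ?b = "C * (1/4) powr k * sqrt (1/2)" and ?I = "{1/4..1/2::real}"
  have int: "set_integrable lborel ?I (\<lambda>\<eta>::real. ?b)"
    by (rule set_integrable_bounded_interval[where B = "\<bar>?b\<bar>"]) (auto simp: set_borel_measurable_def)
  have "0 < ?b * (1/4)"
    using assms by simp
  also have "\<dots> = (LINT \<eta>:?I|lborel. ?b)"
    by (simp add: set_lebesgue_integral_def)
  also have "\<dots> \<le> (LINT \<eta>:?I|lborel. Phi0 C k \<eta> * sqrt (1 - \<eta>))"
  proof (rule set_integral_mono[OF int])
    show "set_integrable lborel ?I (\<lambda>\<eta>. Phi0 C k \<eta> * sqrt (1 - \<eta>))"
      by (rule set_integrable_subset[OF g_newt_integrable[OF assms(1), of 1]]) auto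
    show "?b \<le> Phi0 C k \<eta> * sqrt (1 - \<eta>)" if "\<eta> \<in> ?I" for \<eta>
      using that assms unfolding Phi0_def by (auto intro!: mult_mono powr_mono2)
  qed
  also have "\<dots> \<le> (LINT \<eta>:{0..1}|lborel. Phi0 C k \<eta> * sqrt (1 - \<eta>))"
    unfolding set_lebesgue_integral_def
  proof (rule integral_mono)
    show "integrable lborel (\<lambda>x. indicat_real ?I x *\<^sub>R (Phi0 C k x * sqrt (1 - x)))"
      using set_integrable_subset[OF g_newt_integrable[OF assms(1), of 1], of "?I" C]
      unfolding set_integrable_def by auto
    show "integrable lborel (\<lambda>x. indicat_real {0..1} x *\<^sub>R (Phi0 C k x * sqrt (1 - x)))"
      using g_newt_integrable[OF assms(1), of 1] unfolding set_integrable_def by auto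
  qed (use assms in \<open>auto simp: indicator_def Phi0_def\<close>)
  finally show ?thesis
    by (simp add: g_newt_def)
qed

text \<open>With \<open>z = 1 - e\<^sup>-\<^sup>y\<close> the root factors as
  \<open>e\<^sup>2\<^sup>y (1 - \<eta>)\<^sup>2 - 1 = (z - \<eta>) (2 - z - \<eta>) / (1 - z)\<^sup>2\<close>, so the weight relative to the
  Newtonian kernel \<open>sqrt (z - \<eta>)\<close> is explicit and equals \<open>sqrt 2 + O(z)\<close>.\<close>

definition rel_weight :: "real \<Rightarrow> real \<Rightarrow> real" where
  "rel_weight z \<eta> = (1 - \<eta>)^2 * sqrt (2 - z - \<eta>) / (1 - z)^4"

lemma rel_root_eq:
  fixes y \<eta> :: real
  assumes "z = 1 - exp (- y)"
  shows "exp (2 * y) * (1 - \<eta>)^2 - 1 = (z - \<eta>) * (2 - z - \<eta>) / (1 - z)^2"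
proof -
  have z: "(1 - z)^2 \<noteq> 0" "exp (2 * y) = 1 / (1 - z)^2"
    by (simp_all add: assms exp_minus power2_eq_square field_simps flip: exp_add)
  have "(1 - \<eta>)^2 - (1 - z)^2 = (z - \<eta>) * (2 - z - \<eta>)"
    by (simp add: power2_eq_square algebra_simps)
  then show ?thesis
    unfolding z(2) using z(1) by (metis diff_divide_distrib divide_self mult_1 times_divide_eq_left)
qed

text \<open>The fourth power in \<open>rel_weight\<close> collects \<open>(1 - z)^3\<close> from
  \<open>exp (3 * y)\<close> and one further factor from the root.\<close>

lemma g_rel_eq:
  assumes y: "0 < y" and z: "z = 1 - exp (- y)"
  shows "g_rel \<Phi> y = 4 * pi * (LINT \<eta>:{0..z}|lborel. \<Phi> \<eta> * (rel_weight z \<eta> * sqrt (z - \<eta>)))"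
proof -
  have e: "1 - z > 0" "exp (3 * y) = 1 / (1 - z)^3"
    using exp_of_nat_mult[of 3 y] by (simp_all add: z exp_minus power_inverse inverse_eq_divide power_one_over)
  have "exp (3 * y) * (LINT \<eta>:{0..z}|lborel. \<Phi> \<eta> * (1 - \<eta>)^2 * sqrt (exp (2 * y) * (1 - \<eta>)^2 - 1)) =
      (LINT \<eta>:{0..z}|lborel. exp (3 * y) * (\<Phi> \<eta> * (1 - \<eta>)^2 * sqrt (exp (2 * y) * (1 - \<eta>)^2 - 1)))"
    by simp
  also have "\<dots> = (LINT \<eta>:{0..z}|lborel. \<Phi> \<eta> * (rel_weight z \<eta> * sqrt (z - \<eta>)))"
  proof (rule set_lebesgue_integral_cong)
    show "\<forall>\<eta>. \<eta> \<in> {0..z} \<longrightarrow> exp (3 * y) * (\<Phi> \<eta> * (1 - \<eta>)^2 * sqrt (exp (2 * y) * (1 - \<eta>)^2 - 1)) =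
        \<Phi> \<eta> * (rel_weight z \<eta> * sqrt (z - \<eta>))"
      unfolding rel_root_eq[OF z] e(2) rel_weight_def using e(1)
      by (simp add: real_sqrt_mult real_sqrt_divide power4_eq_xxxx power3_eq_cube)
  qed simp
  finally show ?thesis
    using y by (simp add: g_rel_def z mult.assoc)
qed

text \<open>The numerator decreases in \<eta>: it is smallest at \<open>\<eta> = z\<close> and never
  exceeds \<open>sqrt 2\<close>. The number 30 comes from \<open>1 / (1 - z) \<le> 1 + 2 * z\<close>
  by squaring twice, each quadratic being replaced by its chord on \<open>{0..1/2}\<close>.\<close>

lemma rel_weight_bounds:
  assumes "0 \<le> \<eta>" "\<eta> \<le> z" "z \<le> 1/2"
  shows "sqrt 2 \<le> rel_weight z \<eta>" "rel_weight z \<eta> \<le> sqrt 2 * (1 + 30 * z)"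
proof -
  have "(1 - z)^4 * sqrt 2 \<le> (1 - z)^2 * (sqrt (1 - z) * sqrt 2)"
  proof -
    have "(1 - z)^2 \<le> (1 - z)^1"
      using assms by (intro power_decreasing) auto
    also have "1 - z \<le> sqrt (1 - z)"
      using assms real_sqrt_le_mono[of "(1 - z)^2" "1 - z"] by (simp add: power2_eq_square mult_le_cancel_left1 mult_left_le)
    finally have "(1 - z)^2 * ((1 - z)^2 * sqrt 2) \<le> (1 - z)^2 * (sqrt (1 - z) * sqrt 2)"
      by (intro mult_left_mono mult_right_mono) auto
    then show ?thesis
      by (simp add: power4_eq_xxxx power2_eq_square mult_ac)
  qed
  also have "\<dots> \<le> (1 - \<eta>)^2 * sqrt (2 - z - \<eta>)"
    unfolding real_sqrt_mult[symmetric] using assms by (intro mult_mono power_mono) auto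
  finally show "sqrt 2 \<le> rel_weight z \<eta>"
    using assms by (simp add: rel_weight_def field_simps)
  have "(1 / (1 - z))^4 \<le> (1 + 2 * z)^4"
  proof (rule power_mono)
    have "0 \<le> z * (1 - 2 * z)"
      using assms by (intro mult_nonneg_nonneg) auto
    then show "1 / (1 - z) \<le> 1 + 2 * z"
      using assms by (simp add: field_simps)
  qed (use assms in auto)
  also have "\<dots> = ((1 + 2 * z)^2)^2"
    by simp
  also have "\<dots> \<le> (1 + 6 * z)^2"
  proof (rule power_mono)
    have "0 \<le> z * (2 - 4 * z)"
      using assms by (intro mult_nonneg_nonneg) auto
    then show "(1 + 2 * z)^2 \<le> 1 + 6 * z"
      by (simp add: power2_eq_square algebra_simps)
  qed simp
  also have "\<dots> \<le> 1 + 30 * z"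
  proof -
    have "0 \<le> z * (18 - 36 * z)"
      using assms by (intro mult_nonneg_nonneg) auto
    then show ?thesis
      by (simp add: power2_eq_square algebra_simps)
  qed
  finally have le1: "1 / (1 - z)^4 \<le> 1 + 30 * z"
    by (simp add: power_one_over)
  have le2: "(1 - \<eta>)^2 * sqrt (2 - z - \<eta>) \<le> 1 * sqrt 2"
    using assms by (intro mult_mono power_le_one) auto
  have "((1 - \<eta>)^2 * sqrt (2 - z - \<eta>)) * (1 / (1 - z)^4) \<le> (1 * sqrt 2) * (1 + 30 * z)"
    by (rule mult_mono[OF le2 le1]) (use assms in auto)
  then show "rel_weight z \<eta> \<le> sqrt 2 * (1 + 30 * z)"
    by (simp add: rel_weight_def)
qed

section \<open>Expansion of density and pressure for small arguments\<close>

lemma one_minus_exp_bounds: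
  fixes y :: real
  assumes "0 < y" "y \<le> 1/2"
  shows "0 < 1 - exp (- y)" "1 - exp (- y) \<le> y" "y - (1 - exp (- y)) \<le> y^2"
proof -
  show "0 < 1 - exp (- y)"
    using assms by simp
  show "1 - exp (- y) \<le> y"
    using exp_ge_add_one_self[of "- y"] by simp
  have "exp (- y) \<le> 1 / (1 + y)"
    using exp_ge_add_one_self[of y] assms by (simp add: exp_minus divide_simps)
  also have "\<dots> \<le> 1 - y + y^2"
  proof -
    \<comment> \<open>The claim is \<open>(1 + y) * (1 - y + y^2) = 1 + y^3 \<ge> 1\<close> after
      division.\<close>
    have "0 \<le> y^3"
      using assms by simp
    then show ?thesis
      using assms by (simp add: divide_simps) (simp add: algebra_simps power2_eq_square power3_eq_cube)
  qed
  finally show "y - (1 - exp (- y)) \<le> y^2"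
    by simp
qed

text \<open>Makes the expansion of \<Phi> uniform over \<open>{0..z}\<close>; since
  \<open>z \<le> 1\<close>, the exponent may be lowered from \<delta> to \<open>d\<close>.\<close>

lemma near_power_le:
  fixes \<Phi> :: "real \<Rightarrow> real"
  assumes "0 < k" "0 < d" "d \<le> \<delta>" "0 \<le> C" "0 \<le> K" "0 \<le> \<eta>" "\<eta> \<le> z" "z \<le> 1" "0 < z"
    and "\<bar>\<Phi> \<eta> - C * \<eta> powr k\<bar> \<le> K * \<eta> powr (k + \<delta>)"
  shows "\<bar>\<Phi> \<eta> - C * \<eta> powr k\<bar> \<le> K * (z powr k * z powr d)" "\<bar>\<Phi> \<eta>\<bar> \<le> (C + K) * z powr k"
proof -
  have "\<eta> powr (k + \<delta>) \<le> z powr (k + \<delta>)"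
    using assms by (intro powr_mono2) auto
  also have "\<dots> \<le> z powr (k + d)"
    using assms by (intro powr_mono') auto
  finally have "K * \<eta> powr (k + \<delta>) \<le> K * (z powr k * z powr d)"
    using assms by (simp add: powr_add mult_left_mono)
  then show *: "\<bar>\<Phi> \<eta> - C * \<eta> powr k\<bar> \<le> K * (z powr k * z powr d)"
    using assms by linarith
  have "K * (z powr k * z powr d) \<le> K * (z powr k * 1)"
    using assms by (intro mult_left_mono powr_le1) auto
  moreover have "C * \<eta> powr k \<le> C * z powr k"
    using assms by (intro mult_left_mono powr_mono2) auto
  moreover have "0 \<le> C * \<eta> powr k"
    using assms by simp
  ultimately show "\<bar>\<Phi> \<eta>\<bar> \<le> (C + K) * z powr k"
    using * by (simp add: algebra_simps)
qed

text \<open>Three errors add up: \<Phi> against its leading power (\<open>16 * K\<close>, as the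
  weight is at most \<open>16 * sqrt 2\<close>), the weight against \<open>sqrt 2\<close>
  (\<open>30 * C\<close>), and \<open>z\<close> against \<open>y\<close> (the term with
  \<open>g_newt C k 1\<close>). The last two are of relative order one, which
  \<open>d \<le> 1\<close> accommodates.\<close>

lemma g_rel_asymptotics:
  fixes \<Phi> :: "real \<Rightarrow> real" and C k d \<delta> K \<eta>\<^sub>1 y :: real
  assumes [measurable]: "\<Phi> \<in> borel_measurable borel"
    and k: "0 < k" and d: "0 < d" "d \<le> \<delta>" "d \<le> 1" and C: "0 < C" and K: "0 \<le> K"
    and near: "\<And>\<eta>. 0 \<le> \<eta> \<Longrightarrow> \<eta> < \<eta>\<^sub>1 \<Longrightarrow> \<bar>\<Phi> \<eta> - C * \<eta> powr k\<bar> \<le> K * \<eta> powr (k + \<delta>)"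
    and y: "0 < y" "y < \<eta>\<^sub>1" "y \<le> 1/2"
  shows "\<bar>g_rel \<Phi> y - g_newt C k 1 * y powr (k + 3/2)\<bar>
      \<le> (4 * pi * sqrt 2 * (16 * K + 30 * C) + g_newt C k 1 * (k + 3/2)) * y powr (k + 3/2 + d)"
proof -
  define z where "z = 1 - exp (- y)"
  define n where "n = k + 3/2"
  define c where "c = g_newt C k 1"
  have z: "0 < z" "z \<le> y" "y - z \<le> y^2" "z \<le> 1/2" "z \<le> 1"
    using one_minus_exp_bounds[OF y(1,3)] y by (auto simp: z_def)
  have c: "0 < c"
    using g_newt_1_pos[OF k C] by (simp add: c_def)
  have pn: "z powr k * z powr d * sqrt z * z = z powr (n + d)"
  proof -
    have "z powr k * z powr d * sqrt z * z = z powr k * z powr d * z powr (1/2) * z powr 1"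
      using z by (simp add: powr_half_sqrt)
    also have "\<dots> = z powr (n + d)"
      unfolding powr_add[symmetric] by (simp add: n_def add_ac)
    finally show ?thesis .
  qed
  define f where "f \<eta> = \<Phi> \<eta> * (rel_weight z \<eta> * sqrt (z - \<eta>))" for \<eta>
  define f0 where "f0 \<eta> = sqrt 2 * (Phi0 C k \<eta> * sqrt (z - \<eta>))" for \<eta>
  define B where "B = sqrt 2 * (16 * K + 30 * C) * (z powr k * z powr d * sqrt z)"
  have f_meas [measurable]: "f \<in> borel_measurable borel" "f0 \<in> borel_measurable borel"
    unfolding f_def rel_weight_def f0_def Phi0_def by measurable
  have w: "sqrt 2 \<le> rel_weight z \<eta>" "rel_weight z \<eta> \<le> sqrt 2 * (1 + 30 * z)" "rel_weight z \<eta> \<le> sqrt 2 * 16"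
    if "\<eta> \<in> {0..z}" for \<eta>
  proof -
    show "sqrt 2 \<le> rel_weight z \<eta>" and *: "rel_weight z \<eta> \<le> sqrt 2 * (1 + 30 * z)"
      using rel_weight_bounds[of \<eta> z] that z by auto
    have "sqrt 2 * (1 + 30 * z) \<le> sqrt 2 * 16"
      using z by (intro mult_left_mono) auto
    then show "rel_weight z \<eta> \<le> sqrt 2 * 16"
      using * by linarith
  qed
  have f_int: "set_integrable lborel {0..z} f"
  proof (rule set_integrable_bounded_interval)
    show "set_borel_measurable borel {0..z} f"
      unfolding set_borel_measurable_def by measurable
    fix \<eta> assume \<eta>: "\<eta> \<in> {0..z}"
    have "\<bar>\<Phi> \<eta>\<bar> \<le> (C + K) * z powr k"
      using near_power_le(2)[where \<Phi> = \<Phi> and \<eta> = \<eta>, OF k d(1,2) less_imp_le[OF C] K _ _ z(5,1) near] \<eta> z y by simp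
    moreover have "\<bar>rel_weight z \<eta>\<bar> \<le> sqrt 2 * 16"
      using w[OF \<eta>] real_sqrt_ge_zero[of 2] by linarith
    moreover have "\<bar>sqrt (z - \<eta>)\<bar> \<le> sqrt z"
      using \<eta> by simp
    ultimately show "\<bar>f \<eta>\<bar> \<le> (C + K) * z powr k * ((sqrt 2 * 16) * sqrt z)"
      unfolding f_def abs_mult using C K z by (intro mult_mono) auto
  qed
  have f0_int: "set_integrable lborel {0..z} f0"
    unfolding f0_def by (intro set_integrable_mult_right g_newt_integrable k)
  have "\<bar>LINT \<eta>:{0..z}|lborel. f \<eta> - f0 \<eta>\<bar> \<le> B * (z - 0)"
  proof (rule abs_set_integral_le)
    show "set_borel_measurable borel {0..z} (\<lambda>\<eta>. f \<eta> - f0 \<eta>)"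
      unfolding set_borel_measurable_def by measurable
    fix \<eta> assume \<eta>: "\<eta> \<in> {0..z}"
    note wb = w[OF \<eta>]
    have Phi0: "Phi0 C k \<eta> = C * \<eta> powr k"
      using \<eta> by (auto simp: Phi0_def)
    have "\<Phi> \<eta> * rel_weight z \<eta> - sqrt 2 * (C * \<eta> powr k) =
        (\<Phi> \<eta> - C * \<eta> powr k) * rel_weight z \<eta> + C * \<eta> powr k * (rel_weight z \<eta> - sqrt 2)"
      by (simp add: algebra_simps)
    also have "\<bar>\<dots>\<bar> \<le> \<bar>\<Phi> \<eta> - C * \<eta> powr k\<bar> * \<bar>rel_weight z \<eta>\<bar> + C * \<eta> powr k * \<bar>rel_weight z \<eta> - sqrt 2\<bar>"
      using C by (intro order_trans[OF abs_triangle_ineq]) (simp add: abs_mult)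
    also have "\<dots> \<le> K * (z powr k * z powr d) * (sqrt 2 * 16) + C * z powr k * (sqrt 2 * (30 * z powr d))"
    proof (intro add_mono mult_mono)
      show "\<bar>\<Phi> \<eta> - C * \<eta> powr k\<bar> \<le> K * (z powr k * z powr d)"
        using near_power_le(1)[where \<Phi> = \<Phi> and \<eta> = \<eta>, OF k d(1,2) less_imp_le[OF C] K _ _ z(5,1) near] \<eta> z y by simp
      show "\<eta> powr k \<le> z powr k"
        using \<eta> k by (intro powr_mono2) auto
      have "z powr 1 \<le> z powr d"
        using z d by (intro powr_mono') auto
      then have "sqrt 2 * (30 * z) \<le> sqrt 2 * (30 * z powr d)"
        using z by (intro mult_left_mono) auto
      moreover have "sqrt 2 * (1 + 30 * z) = sqrt 2 + sqrt 2 * (30 * z)"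
        by (simp add: distrib_left)
      ultimately show "\<bar>rel_weight z \<eta> - sqrt 2\<bar> \<le> sqrt 2 * (30 * z powr d)"
        using wb by linarith
      show "\<bar>rel_weight z \<eta>\<bar> \<le> sqrt 2 * 16"
        using wb real_sqrt_ge_zero[of 2] by linarith
    qed (use C K in auto)
    also have "\<dots> = sqrt 2 * (16 * K + 30 * C) * (z powr k * z powr d)"
      by (simp add: algebra_simps)
    finally have "\<bar>\<Phi> \<eta> * rel_weight z \<eta> - sqrt 2 * (C * \<eta> powr k)\<bar> * \<bar>sqrt (z - \<eta>)\<bar> \<le>
        sqrt 2 * (16 * K + 30 * C) * (z powr k * z powr d) * sqrt z"
      using \<eta> K C by (intro mult_mono) auto
    moreover have "f \<eta> - f0 \<eta> = (\<Phi> \<eta> * rel_weight z \<eta> - sqrt 2 * (C * \<eta> powr k)) * sqrt (z - \<eta>)"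
      by (simp add: f_def f0_def Phi0 algebra_simps)
    ultimately show "\<bar>f \<eta> - f0 \<eta>\<bar> \<le> B"
      by (simp add: B_def abs_mult mult.assoc)
  qed (use z in auto)
  also have "B * (z - 0) = sqrt 2 * (16 * K + 30 * C) * z powr (n + d)"
    by (simp add: B_def mult.assoc flip: pn)
  also have "\<dots> \<le> sqrt 2 * (16 * K + 30 * C) * y powr (n + d)"
    using z k d K C by (intro mult_left_mono powr_mono2) (auto simp: n_def)
  finally have "4 * pi * \<bar>LINT \<eta>:{0..z}|lborel. f \<eta> - f0 \<eta>\<bar> \<le>
      4 * pi * (sqrt 2 * (16 * K + 30 * C) * y powr (n + d))"
    by (intro mult_left_mono) auto
  moreover have "g_rel \<Phi> y - c * z powr n = 4 * pi * (LINT \<eta>:{0..z}|lborel. f \<eta> - f0 \<eta>)"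
  proof -
    have "c * z powr n = 4 * pi * (LINT \<eta>:{0..z}|lborel. f0 \<eta>)"
      using z g_newt_eq[OF k, of C z] by (simp add: c_def n_def g_newt_def f0_def)
    moreover have "g_rel \<Phi> y = 4 * pi * (LINT \<eta>:{0..z}|lborel. f \<eta>)"
      by (simp add: g_rel_eq[OF y(1) z_def] f_def)
    ultimately show ?thesis
      unfolding set_integral_diff(2)[OF f_int f0_int] by (simp add: algebra_simps)
  qed
  ultimately have 1: "\<bar>g_rel \<Phi> y - c * z powr n\<bar> \<le> 4 * pi * (sqrt 2 * (16 * K + 30 * C) * y powr (n + d))"
    by (simp add: abs_mult)
  \<comment> \<open>Passing from \<open>z\<close> to \<open>y\<close> costs the slope
    \<open>n * y powr (n - 1)\<close> times \<open>y - z \<le> y^2\<close>, one order beyond the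
    leading term.\<close>
  have "y powr n - z powr n \<le> n * y powr (n - 1) * (y - z)"
    using z k y by (intro powr_diff_le) (auto simp: n_def)
  also have "\<dots> \<le> n * y powr (n - 1) * y^2"
    using z k by (intro mult_left_mono) (auto simp: n_def)
  also have "\<dots> = n * y powr (n + 1)"
  proof -
    have "y powr (n + 1) = y powr (n - 1 + 2)"
      by (simp add: add.commute)
    also have "\<dots> = y powr (n - 1) * y^2"
      unfolding powr_add using y by (simp add: powr_numeral)
    finally show ?thesis
      by simp
  qed
  also have "\<dots> \<le> n * y powr (n + d)"
    using y d k by (intro mult_left_mono powr_mono') (auto simp: n_def)
  finally have "c * (y powr n - z powr n) \<le> c * (n * y powr (n + d))"
    using c by (intro mult_left_mono) auto
  moreover have "c * z powr n \<le> c * y powr n"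
    using c z k by (intro mult_left_mono powr_mono2) (auto simp: n_def)
  ultimately have "\<bar>c * z powr n - c * y powr n\<bar> \<le> c * (n * y powr (n + d))"
    by (simp add: algebra_simps)
  with 1 have "\<bar>g_rel \<Phi> y - c * y powr n\<bar> \<le> (4 * pi * sqrt 2 * (16 * K + 30 * C) + c * n) * y powr (n + d)"
    by (simp add: algebra_simps)
  then show ?thesis
    by (simp add: c_def n_def)
qed

text \<open>The root enters with exponent 3/2 instead of 1/2, hence one more power of
  \<open>y\<close> than in the density. An upper bound suffices because the pressure carries a
  factor \<kappa> in the rescaled equation.\<close>

lemma P_rel_bound:
  fixes \<Phi> :: "real \<Rightarrow> real" and C k \<delta> K \<eta>\<^sub>1 y :: real
  assumes [measurable]: "\<Phi> \<in> borel_measurable borel"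
    and k: "0 < k" and \<delta>: "0 < \<delta>" and C: "0 < C" and K: "0 \<le> K"
    and near: "\<And>\<eta>. 0 \<le> \<eta> \<Longrightarrow> \<eta> < \<eta>\<^sub>1 \<Longrightarrow> \<bar>\<Phi> \<eta> - C * \<eta> powr k\<bar> \<le> K * \<eta> powr (k + \<delta>)"
    and y: "0 < y" "y < \<eta>\<^sub>1" "y \<le> 1/2"
  shows "P_rel \<Phi> y \<le> 8 * pi / 3 * ((C + K) * 8 powr (3/2)) * y powr (k + 5/2)"
proof -
  define z where "z = 1 - exp (- y)"
  have z: "0 < z" "z \<le> y" "z \<le> 1/2" "z \<le> 1"
    using one_minus_exp_bounds[OF y(1,3)] y by (auto simp: z_def)
  let ?I = "LINT \<eta>:{0..z}|lborel. \<Phi> \<eta> * (exp (2 * y) * (1 - \<eta>)^2 - 1) powr (3/2)"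
  have "\<bar>?I\<bar> \<le> ((C + K) * z powr k * (8 * z) powr (3/2)) * (z - 0)"
  proof (rule abs_set_integral_le)
    show "set_borel_measurable borel {0..z} (\<lambda>\<eta>. \<Phi> \<eta> * (exp (2 * y) * (1 - \<eta>)^2 - 1) powr (3/2))"
      unfolding set_borel_measurable_def by measurable
    fix \<eta> assume \<eta>: "\<eta> \<in> {0..z}"
    have "\<bar>\<Phi> \<eta>\<bar> \<le> (C + K) * z powr k"
      using near_power_le(2)[where \<Phi> = \<Phi> and \<eta> = \<eta>, OF k \<delta> order_refl less_imp_le[OF C] K _ _ z(4,1) near] \<eta> z y by simp
    moreover have "(exp (2 * y) * (1 - \<eta>)^2 - 1) powr (3/2) \<le> (8 * z) powr (3/2)"
      unfolding rel_root_eq[OF z_def]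
    proof (rule powr_mono2)
      \<comment> \<open>The numerator of the radicand is at most \<open>2 * z\<close> and its
        denominator at least 1/4, hence \<open>8 * z\<close>.\<close>
      have "(1/2)^2 \<le> (1 - z)^2"
        using z by (intro power_mono) auto
      then have "(z - \<eta>) * (2 - z - \<eta>) / (1 - z)^2 \<le> (z * 2) / (1/2)^2"
        using \<eta> z by (intro frac_le mult_mono) auto
      then show "(z - \<eta>) * (2 - z - \<eta>) / (1 - z)^2 \<le> 8 * z"
        by (simp add: power2_eq_square)
    qed (use \<eta> z in auto)
    ultimately show "\<bar>\<Phi> \<eta> * (exp (2 * y) * (1 - \<eta>)^2 - 1) powr (3/2)\<bar> \<le> (C + K) * z powr k * (8 * z) powr (3/2)"
      unfolding abs_mult using C K by (intro mult_mono) auto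
  qed (use z in auto)
  also have "\<dots> = (C + K) * 8 powr (3/2) * z powr (k + 5/2)"
  proof -
    have "z powr (k + 5/2) = z powr (k + 3/2 + 1)"
      by (simp add: add_ac)
    also have "\<dots> = z powr k * z powr (3/2) * z"
      unfolding powr_add using z by simp
    finally show ?thesis
      using z by (simp add: powr_mult)
  qed
  also have "\<dots> \<le> (C + K) * 8 powr (3/2) * y powr (k + 5/2)"
    using z k K C by (intro mult_left_mono powr_mono2) auto
  finally have I: "?I \<le> (C + K) * 8 powr (3/2) * y powr (k + 5/2)"
    by linarith
  have "exp y \<le> 2"
    using exp_bound_half[of y] y by simp
  then have "(4 * pi / 3 * exp y) * ?I \<le> (4 * pi / 3 * 2) * ((C + K) * 8 powr (3/2) * y powr (k + 5/2))"
    using I C K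
    by (intro order_trans[OF mult_left_mono[OF I] mult_right_mono]) auto
  then show ?thesis
    using y by (simp add: P_rel_def z_def)
qed

section \<open>Rescaling\<close>

lemma mass_rescale:
  assumes "0 < l"
  shows "mass g y (l * s) = l^3 * mass g (\<lambda>s. y (l * s)) s"
proof -
  have "(LINT \<sigma>:{0..l * s}|lborel. \<sigma>^2 * g (y \<sigma>)) =
      \<bar>l\<bar> *\<^sub>R (LINT t|lborel. indicator {0..l * s} (0 + l * t) *\<^sub>R ((0 + l * t)^2 * g (y (0 + l * t))))"
    unfolding set_lebesgue_integral_def using assms by (intro lborel_integral_real_affine) simp
  also have "(\<lambda>t. indicator {0..l * s} (0 + l * t) *\<^sub>R ((0 + l * t)^2 * g (y (0 + l * t)))) =
      (\<lambda>t. l^2 * (indicator {0..s} t *\<^sub>R (t^2 * g (y (l * t)))))"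
    using assms by (auto simp: indicator_def zero_le_mult_iff power_mult_distrib)
  finally show ?thesis
    using assms by (simp add: mass_def set_lebesgue_integral_def power2_eq_square power3_eq_cube)
qed

lemma mass_cmult: "mass (\<lambda>x. b * g x) y r = b * mass g y r"
  by (simp add: mass_def mult.left_commute)

lemma le_initial:
  fixes y :: "real \<Rightarrow> real"
  assumes "continuous_on {0..} y" "0 \<le> s"
    and "\<And>s. 0 < s \<Longrightarrow> (y has_real_derivative y' s) (at s)" "\<And>s. 0 < s \<Longrightarrow> y' s \<le> 0"
  shows "y s \<le> y 0"
proof (rule DERIV_nonpos_imp_decreasing_open[OF assms(2)])
  show "continuous_on {0..s} y"
    by (rule continuous_on_subset[OF assms(1)]) auto
  fix x assume "0 < x" "x < s"
  then show "\<exists>d. (y has_real_derivative d) (at x) \<and> d \<le> 0"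
    using assms(3,4)[of x] by (intro exI[of _ "y' x"] conjI) auto
qed

text \<open>The length scale \<open>l\<close> stays free here: the form of the rescaled equation
  holds for every \<open>l\<close>, and only the limit of the density singles out a power of
  \<kappa>.\<close>

locale rescaled_solution =
  fixes \<Phi> Y :: "real \<Rightarrow> real" and \<kappa> l :: real
  assumes sol: "is_rel_solution \<Phi> \<kappa> Y" and \<kappa>_pos: "0 < \<kappa>" and l_pos: "0 < l"
begin

definition z :: "real \<Rightarrow> real" where "z s = Y (l * s) / \<kappa>"
text \<open>For \<open>l = \<kappa> powr (- ((k + 1/2) / 2))\<close> this and \<open>h\<close> are
  the rescaled density and pressure functions of the problem, expressed through \<open>g_rel\<close>
  and \<open>P_rel\<close> instead of expanded integrals.\<close>

definition g :: "real \<Rightarrow> real" where "g x = l^2 / \<kappa> * g_rel \<Phi> (\<kappa> * x)"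
definition h :: "real \<Rightarrow> real" where "h x = l^2 / \<kappa>^2 * P_rel \<Phi> (\<kappa> * x)"

lemma z_0: "z 0 = 1"
  using sol \<kappa>_pos by (simp add: z_def is_rel_solution_def)

lemma z_continuous: "continuous_on {0..} z"
proof -
  have "continuous_on {0..} Y"
    using sol by (simp add: is_rel_solution_def)
  then have "continuous_on {0..} (\<lambda>s. Y (l * s))"
    by (rule continuous_on_compose2) (use l_pos in \<open>auto intro: continuous_intros\<close>)
  then show ?thesis
    unfolding z_def[abs_def] using \<kappa>_pos by (intro continuous_on_divide continuous_on_const) auto
qed

lemma mass_eq: "mass_rel \<Phi> Y (l * s) = l * \<kappa> * mass g z s"
proof -
  have Y: "\<kappa> * z s = Y (l * s)" for s
    using \<kappa>_pos by (simp add: z_def)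
  have "mass g z s = l^2 / \<kappa> * mass (\<lambda>x. g_rel \<Phi> (\<kappa> * x)) z s"
    unfolding g_def[abs_def] by (rule mass_cmult)
  also have "mass (\<lambda>x. g_rel \<Phi> (\<kappa> * x)) z s = mass (g_rel \<Phi>) (\<lambda>s. Y (l * s)) s"
    unfolding mass_def Y ..
  finally have "l * \<kappa> * mass g z s = l^3 * mass (g_rel \<Phi>) (\<lambda>s. Y (l * s)) s"
    using \<kappa>_pos by (simp add: power2_eq_square power3_eq_cube)
  then show ?thesis
    using mass_rescale[OF l_pos, of "g_rel \<Phi>" Y s] by (simp add: mass_rel_def mass_def)
qed

text \<open>The length scale cancels and one factor \<kappa> remains, which is why the metric factor
  tends to 1.\<close>

lemma mass_over_r: "2 * mass_rel \<Phi> Y (l * s) / (l * s) = 2 * \<kappa> * mass g z s / s"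
  using l_pos by (simp add: mass_eq)

lemma sol_at:
  assumes "0 < s"
  shows "0 < 1 - 2 * mass_rel \<Phi> Y (l * s) / (l * s)"
    "(Y has_real_derivative - (1 / (1 - 2 * mass_rel \<Phi> Y (l * s) / (l * s))) *
      (mass_rel \<Phi> Y (l * s) / (l * s)^2 + 4 * pi * (l * s) * P_rel \<Phi> (Y (l * s)))) (at (l * s))"
  using sol mult_pos_pos[OF l_pos assms] unfolding is_rel_solution_def by blast+

lemma metric_pos: "0 < s \<Longrightarrow> 0 < 1 - 2 * \<kappa> * mass g z s / s"
  using sol_at(1) unfolding mass_over_r .

lemma z_deriv:
  assumes s: "0 < s"
  shows "(z has_real_derivative - (1 / (1 - 2 * \<kappa> * mass g z s / s)) *
      (mass g z s / s^2 + 4 * pi * \<kappa> * s * h (z s))) (at s)"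
proof -
  define u where "u = 1 / (1 - 2 * \<kappa> * mass g z s / s)"
  have "(Y has_real_derivative - u * (mass_rel \<Phi> Y (l * s) / (l * s)^2 + 4 * pi * (l * s) * P_rel \<Phi> (Y (l * s)))) (at (l * s))"
    using sol_at(2)[OF s] unfolding mass_over_r u_def .
  then have "(Y has_real_derivative - u * (mass_rel \<Phi> Y (l * s) / (l * s)^2 + 4 * pi * (l * s) * P_rel \<Phi> (Y (l * s)))) (at ((*) l s))"
    by simp
  from DERIV_cdivide[OF DERIV_chain2[OF this DERIV_cmult_Id], of \<kappa>]
  have "(z has_real_derivative - u * (mass_rel \<Phi> Y (l * s) / (l * s)^2 + 4 * pi * (l * s) * P_rel \<Phi> (Y (l * s))) * l / \<kappa>) (at s)"
    by (simp add: z_def[abs_def])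
  moreover have "- u * (mass_rel \<Phi> Y (l * s) / (l * s)^2 + 4 * pi * (l * s) * P_rel \<Phi> (Y (l * s))) * l / \<kappa> =
      - u * (mass g z s / s^2 + 4 * pi * \<kappa> * s * h (z s))"
  proof -
    have m: "mass_rel \<Phi> Y (l * s) / (l * s)^2 * l / \<kappa> = mass g z s / s^2"
      unfolding mass_eq using \<kappa>_pos l_pos by (simp add: power2_eq_square)
    have p: "4 * pi * (l * s) * P_rel \<Phi> (Y (l * s)) * l / \<kappa> = 4 * pi * \<kappa> * s * h (z s)"
      using \<kappa>_pos by (simp add: h_def z_def power2_eq_square)
    have "- u * (a + b) * l / \<kappa> = - u * (a * l / \<kappa> + b * l / \<kappa>)" for a b
      by (simp add: algebra_simps add_divide_distrib diff_divide_distrib)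
    then show ?thesis
      unfolding m[symmetric] p[symmetric] .
  qed
  ultimately show ?thesis
    by (simp only: u_def)
qed

lemma z_le:
  assumes "\<And>\<eta>. 0 \<le> \<Phi> \<eta>" "0 \<le> s"
  shows "z s \<le> 1"
proof -
  have "z s \<le> z 0"
  proof (rule le_initial[OF z_continuous assms(2) z_deriv])
    fix s :: real assume s: "0 < s"
    have "0 \<le> mass g z s"
      using \<kappa>_pos by (auto intro!: mass_nonneg mult_nonneg_nonneg simp: g_def g_rel_nonneg assms)
    then have "0 \<le> 1 / (1 - 2 * \<kappa> * mass g z s / s) * (mass g z s / s^2 + 4 * pi * \<kappa> * s * h (z s))"
      using metric_pos[OF s] s \<kappa>_pos
      by (intro mult_nonneg_nonneg add_nonneg_nonneg) (auto simp: h_def P_rel_nonneg assms)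
    then show "- (1 / (1 - 2 * \<kappa> * mass g z s / s)) * (mass g z s / s^2 + 4 * pi * \<kappa> * s * h (z s)) \<le> 0"
      by simp
  qed
  then show ?thesis
    by (simp add: z_0)
qed

end

section \<open>Choice of constants and transfer to the original solutions\<close>

theorem theorem3p1:
  fixes \<Phi> :: "real \<Rightarrow> real" and C\<^sub>\<Phi> k \<delta> :: real
    and Y :: "real \<Rightarrow> real \<Rightarrow> real" and y0 :: "real \<Rightarrow> real"
  assumes meas: "\<Phi> \<in> borel_measurable borel"
    and nonneg: "\<And>\<eta>. \<Phi> \<eta> \<ge> 0"
    and neg_zero: "\<And>\<eta>. \<eta> < 0 \<Longrightarrow> \<Phi> \<eta> = 0"
    and k_pos: "0 < k" and k_lt: "k < 3 / 2"
    and \<delta>_pos: "\<delta> > 0" and C_pos: "C\<^sub>\<Phi> > 0"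
    and asym: "(\<lambda>\<eta>. \<Phi> \<eta> - C\<^sub>\<Phi> * \<eta> powr k) \<in> O[at_right 0](\<lambda>\<eta>. \<eta> powr (k + \<delta>))"
    and Ysol: "\<And>\<kappa>. \<kappa> > 0 \<Longrightarrow> is_rel_solution \<Phi> \<kappa> (Y \<kappa>)"
    and y0sol: "is_newt_solution C\<^sub>\<Phi> k y0"
  shows "\<exists>\<delta>\<^sub>1 > 0. \<exists>C > 0. \<exists>\<kappa>\<^sub>0 > 0. \<forall>\<kappa>. 0 < \<kappa> \<and> \<kappa> \<le> \<kappa>\<^sub>0 \<longrightarrow>
           (\<forall>s \<ge> 0. \<bar>Y \<kappa> (\<kappa> powr (- ((k + 1/2) / 2)) * s) / \<kappa> - y0 s\<bar> \<le> C * \<kappa> powr \<delta>\<^sub>1)"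
proof -
  define n where "n = k + 3/2"
  \<comment> \<open>The profile \<Phi> contributes an error of relative order \<delta>, the
    relativistic kernel one of relative order 1; the worse rate wins.\<close>
  define d where "d = min \<delta> 1"
  define c where "c = g_newt C\<^sub>\<Phi> k 1"
  have d: "0 < d" "d \<le> \<delta>" "d \<le> 1" and n: "1 < n" "n < 3" and c: "0 < c"
    using \<delta>_pos k_pos k_lt g_newt_1_pos[OF k_pos C_pos] by (auto simp: d_def n_def c_def)
  obtain K where K: "0 < K"
    and "\<forall>\<^sub>F \<eta> in at_right 0. norm (\<Phi> \<eta> - C\<^sub>\<Phi> * \<eta> powr k) \<le> K * norm (\<eta> powr (k + \<delta>))"
    using landau_o.bigE[OF asym] by blast
  then obtain \<eta>\<^sub>1 where \<eta>\<^sub>1: "0 < \<eta>\<^sub>1"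
    and near: "\<And>\<eta>. 0 < \<eta> \<Longrightarrow> \<eta> < \<eta>\<^sub>1 \<Longrightarrow> \<bar>\<Phi> \<eta> - C\<^sub>\<Phi> * \<eta> powr k\<bar> \<le> K * \<eta> powr (k + \<delta>)"
    unfolding eventually_at_right_field by auto
  define \<Psi> where "\<Psi> = \<Phi>(0 := 0)" \<comment> \<open>\<open>\<Phi> 0\<close> is arbitrary, but invisible to the integrals\<close>
  have \<Psi>_meas: "\<Psi> \<in> borel_measurable borel"
    unfolding \<Psi>_def fun_upd_def using meas by measurable
  have \<Psi>_near: "\<bar>\<Psi> \<eta> - C\<^sub>\<Phi> * \<eta> powr k\<bar> \<le> K * \<eta> powr (k + \<delta>)" if "0 \<le> \<eta>" "\<eta> < \<eta>\<^sub>1" for \<eta>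
    using near[of \<eta>] that by (cases "\<eta> = 0") (auto simp: \<Psi>_def)
  have gP: "g_rel \<Phi> = g_rel \<Psi>" "P_rel \<Phi> = P_rel \<Psi>"
    by (intro g_rel_cong P_rel_cong meas \<Psi>_meas; simp add: \<Psi>_def)+
  define K1 where "K1 = 4 * pi * sqrt 2 * (16 * K + 30 * C\<^sub>\<Phi>) + c * n"
  define K2 where "K2 = 8 * pi / 3 * ((C\<^sub>\<Phi> + K) * 8 powr (3/2))"
  have K12: "0 \<le> K1" "0 \<le> K2"
    using K C_pos c n by (auto simp: K1_def K2_def)
  have g_asym: "\<bar>g_rel \<Phi> y - c * y powr n\<bar> \<le> K1 * y powr (n + d)"
    and P_le: "P_rel \<Phi> y \<le> K2 * y powr (n + 1)"
    if "0 < y" "y < \<eta>\<^sub>1" "y \<le> 1/2" for y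
    using g_rel_asymptotics[OF \<Psi>_meas k_pos d C_pos less_imp_le[OF K] \<Psi>_near that]
      P_rel_bound[OF \<Psi>_meas k_pos \<delta>_pos C_pos less_imp_le[OF K] \<Psi>_near that]
    by (simp_all add: gP K1_def K2_def n_def c_def add.commute)
  define A where "A = K1 + K2"
  have A: "0 \<le> A"
    using K12 by (simp add: A_def)
  define g0 where "g0 = (\<lambda>x. if x \<le> 0 then 0 else c * x powr n)"
  have g0: "g_newt C\<^sub>\<Phi> k = g0"
    unfolding g0_def c_def n_def by (rule ext) (rule g_newt_eq[OF k_pos])
  have g0_bd: "0 \<le> g0 x" "x \<le> 1 \<Longrightarrow> g0 x \<le> c" for x
    using c n powr_mono2[of n x 1] by (auto simp: g0_def intro: mult_left_le)
  have y0: "y0 0 = 1" "continuous_on {0..} y0"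
    "\<And>s. 0 < s \<Longrightarrow> (y0 has_real_derivative - mass g0 y0 s / s^2) (at s)"
    using y0sol by (auto simp: is_newt_solution_def mass_newt_def mass_def g0)
  have "y0 s \<le> 1" if "0 \<le> s" for s
    using le_initial[OF y0(2) that y0(3)] y0(1) mass_nonneg[OF g0_bd(1)] by (simp add: zero_le_divide_iff)
  \<comment> \<open>The bound is enlarged by \<open>A\<close> so that the Newtonian and all rescaled
    densities share it.\<close>
  moreover have "g0 x \<le> c + A" if "x \<le> 1" for x
    using g0_bd(2)[OF that] A by linarith
  moreover have "g0 \<in> borel_measurable borel"
    unfolding g0_def by measurable
  ultimately have D0: "bounded_density g0 y0 (c + A)"
    using y0(2) g0_bd(1) by unfold_locales auto
  obtain C' \<epsilon>\<^sub>0 where C': "0 < C'" and \<epsilon>\<^sub>0: "0 < \<epsilon>\<^sub>0"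
    and limit: "\<And>g z h \<kappa> \<epsilon> s. perturbed_newton g z (c + A) g0 h \<kappa> \<epsilon> A \<Longrightarrow> \<epsilon> \<le> \<epsilon>\<^sub>0 \<Longrightarrow> 0 \<le> s \<Longrightarrow>
           \<bar>z s - y0 s\<bar> \<le> C' * \<epsilon>"
    using newton_limit[OF g0_def D0 c n A y0(1) y0(3)] by blast
  \<comment> \<open>The first two entries keep \<open>\<kappa> * x\<close> with
    \<open>x \<le> 1\<close> in the range of the expansions; the third gives
    \<open>\<kappa> powr d \<le> \<epsilon>\<^sub>0\<close>.\<close>
  define \<kappa>\<^sub>0 where "\<kappa>\<^sub>0 = min (1/2) (min (\<eta>\<^sub>1 / 2) (\<epsilon>\<^sub>0 powr (1 / d)))"
  have \<kappa>\<^sub>0: "0 < \<kappa>\<^sub>0"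
    using \<eta>\<^sub>1 \<epsilon>\<^sub>0 by (simp add: \<kappa>\<^sub>0_def)
  have "\<bar>Y \<kappa> (\<kappa> powr (- ((k + 1/2) / 2)) * s) / \<kappa> - y0 s\<bar> \<le> C' * \<kappa> powr d"
    if \<kappa>: "0 < \<kappa>" "\<kappa> \<le> \<kappa>\<^sub>0" and s: "0 \<le> s" for \<kappa> s
  proof -
    define l where "l = \<kappa> powr (- ((k + 1/2) / 2))"
    interpret rescaled_solution \<Phi> "Y \<kappa>" \<kappa> l
      using Ysol \<kappa> by unfold_locales (auto simp: l_def)
    have \<kappa>_small: "\<kappa> \<le> 1/2" "\<kappa> < \<eta>\<^sub>1"
      using \<kappa> \<eta>\<^sub>1 by (auto simp: \<kappa>\<^sub>0_def)
    have \<epsilon>: "\<kappa> powr d \<le> \<epsilon>\<^sub>0" "\<kappa> \<le> \<kappa> powr d" "\<kappa> powr d \<le> 1"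
    proof -
      have "\<kappa> powr d \<le> (\<epsilon>\<^sub>0 powr (1 / d)) powr d"
        using \<kappa> d by (intro powr_mono2) (auto simp: \<kappa>\<^sub>0_def)
      then show "\<kappa> powr d \<le> \<epsilon>\<^sub>0"
        using d \<epsilon>\<^sub>0 by (simp add: powr_powr)
      show "\<kappa> \<le> \<kappa> powr d"
        using powr_mono'[of d 1 \<kappa>] d \<kappa> \<kappa>_small by simp
      show "\<kappa> powr d \<le> 1"
        using d \<kappa> \<kappa>_small by (intro powr_le1) auto
    qed
    \<comment> \<open>With \<open>a = (k + 1/2) / 2\<close> one has \<open>2 * a + 1 = n\<close>:
      the scale is chosen so that \<open>l^2 / \<kappa>\<close> cancels the homogeneity of the
      density, and \<open>l^2 / \<kappa>^2\<close> that of the pressure bound.\<close>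
    have l2: "l^2 / \<kappa> = \<kappa> powr (- n)" "l^2 / \<kappa>^2 = \<kappa> powr (- (n + 1))"
    proof -
      have l2: "l^2 = \<kappa> powr (1 + - n)"
        unfolding l_def power2_eq_square powr_add[symmetric] n_def by (rule arg_cong) simp
      have mult: "\<kappa> powr (1 + r) = \<kappa> * \<kappa> powr r" for r
        using powr_mult_base[of \<kappa> r] \<kappa>(1) by simp
      have n1: "\<kappa> powr (- n) = \<kappa> * \<kappa> powr (- (n + 1))"
        using mult[of "- (n + 1)"] by simp
      show "l^2 / \<kappa> = \<kappa> powr (- n)"
        unfolding l2 mult using \<kappa>(1) by simp
      show "l^2 / \<kappa>^2 = \<kappa> powr (- (n + 1))"
        unfolding l2 mult n1 using \<kappa>(1) by (simp add: power2_eq_square)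
    qed
    have vac: "g x = 0" "h x = 0" if "x \<le> 0" for x
      using mult_nonneg_nonpos[of \<kappa> x] that \<kappa>(1) by (simp_all add: g_def h_def g_rel_def P_rel_def)
    have in_range: "0 < \<kappa> * x" "\<kappa> * x < \<eta>\<^sub>1" "\<kappa> * x \<le> 1/2" if "0 < x" "x \<le> 1" for x
    proof -
      show "0 < \<kappa> * x"
        using \<kappa>(1) that by simp
      have "\<kappa> * x \<le> \<kappa>"
        using \<kappa>(1) that by simp
      then show "\<kappa> * x < \<eta>\<^sub>1" "\<kappa> * x \<le> 1/2"
        using \<kappa>_small by linarith+
    qed
    \<comment> \<open>For \<open>q = 0\<close>, the leading term and the pressure, the powers of
      \<kappa> cancel exactly; for \<open>q = d\<close>, the remainder, the rate
      \<open>\<kappa> powr d\<close> is left over.\<close>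
    have scaling: "\<kappa> powr (- p) * (b * (\<kappa> * x) powr (p + q)) = b * \<kappa> powr q * x powr (p + q)"
      if "0 < x" for b p q x
    proof -
      have "\<kappa> powr (- p) * (b * (\<kappa> * x) powr (p + q)) = b * (\<kappa> powr (- p) * \<kappa> powr (p + q)) * x powr (p + q)"
        using that \<kappa>(1) by (simp add: powr_mult)
      then show ?thesis
        by (simp flip: powr_add)
    qed
    have close: "\<bar>g x - g0 x\<bar> \<le> A * \<kappa> powr d" if x: "x \<le> 1" for x
    proof (cases "x \<le> 0")
      case True
      then show ?thesis
        using vac A by (simp add: g0_def)
    next
      case False
      have scale: "\<kappa> powr (- n) * (c * (\<kappa> * x) powr n) = c * x powr n"
        "\<kappa> powr (- n) * (K1 * (\<kappa> * x) powr (n + d)) = K1 * \<kappa> powr d * x powr (n + d)"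
        using scaling[of x n c 0] scaling[of x n K1 d] False \<kappa>(1) by simp_all
      have "\<bar>g_rel \<Phi> (\<kappa> * x) - c * (\<kappa> * x) powr n\<bar> \<le> K1 * (\<kappa> * x) powr (n + d)"
        using False x by (intro g_asym in_range) auto
      then have "\<kappa> powr (- n) * \<bar>g_rel \<Phi> (\<kappa> * x) - c * (\<kappa> * x) powr n\<bar> \<le>
          \<kappa> powr (- n) * (K1 * (\<kappa> * x) powr (n + d))"
        by (rule mult_left_mono) (rule powr_ge_zero)
      moreover have "\<kappa> powr (- n) * (K1 * (\<kappa> * x) powr (n + d)) = K1 * \<kappa> powr d * x powr (n + d)"
        unfolding scale(2) by simp
      moreover have "\<kappa> powr (- n) * \<bar>g_rel \<Phi> (\<kappa> * x) - c * (\<kappa> * x) powr n\<bar> = \<bar>g x - g0 x\<bar>"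
      proof -
        have "g x - g0 x = \<kappa> powr (- n) * (g_rel \<Phi> (\<kappa> * x) - c * (\<kappa> * x) powr n)"
          unfolding g_def l2 scale(1) right_diff_distrib using False by (simp add: g0_def)
        then show ?thesis
          by (simp add: abs_mult)
      qed
      moreover have "K1 * \<kappa> powr d * x powr (n + d) \<le> A * \<kappa> powr d * 1"
        using K12 False x n d by (intro mult_mono powr_le1) (auto simp: A_def)
      ultimately show ?thesis
        by simp
    qed
    have h_nonneg: "0 \<le> h x" for x
      by (simp add: h_def P_rel_nonneg nonneg)
    have h_le: "h x \<le> A" if x: "x \<le> 1" for x
    proof (cases "x \<le> 0")
      case True
      then show ?thesis
        using vac A by simp
    next
      case False
      have "P_rel \<Phi> (\<kappa> * x) \<le> K2 * (\<kappa> * x) powr (n + 1)"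
        using False x by (intro P_le in_range) auto
      then have "h x \<le> \<kappa> powr (- (n + 1)) * (K2 * (\<kappa> * x) powr (n + 1))"
        unfolding h_def l2 by (rule mult_left_mono) (rule powr_ge_zero)
      also have "\<dots> = K2 * x powr (n + 1)"
        using scaling[of x "n + 1" K2 0] False \<kappa>(1) by simp
      also have "\<dots> \<le> A * 1"
        using K12 False x n by (intro mult_mono powr_le1) (auto simp: A_def)
      finally show ?thesis
        by simp
    qed
    have dens: "bounded_density g z (c + A)"
    proof
      show "g \<in> borel_measurable borel"
        unfolding g_def[abs_def] using g_rel_measurable[OF meas] by measurable
      show "0 \<le> g x" for x
        using \<kappa> by (simp add: g_def g_rel_nonneg nonneg)
      show "g x \<le> c + A" if "x \<le> 1" for x
      proof -
        have "A * \<kappa> powr d \<le> A * 1"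
          using A \<epsilon> by (intro mult_left_mono) auto
        then show ?thesis
          using close[OF that] g0_bd(2)[OF that] by linarith
      qed
    qed (use z_continuous z_le nonneg in auto)
    have "perturbed_newton g z (c + A) g0 h \<kappa> (\<kappa> powr d) A"
      by (intro perturbed_newton.intro dens perturbed_newton_axioms.intro)
        (fact \<kappa>(1) \<epsilon>(2) close vac h_nonneg h_le z_0 metric_pos z_deriv)+
    then have "\<bar>z s - y0 s\<bar> \<le> C' * \<kappa> powr d"
      using \<epsilon>(1) s by (rule limit)
    then show ?thesis
      by (simp add: z_def flip: l_def)
  qed
  then show ?thesis
    using d(1) C' \<kappa>\<^sub>0 by blast
qed

end
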